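(* Let $\sigma$ be a finite relational signature and $d\in\mathbb{N}$. For every non-empty property $\mathcal{P}\subseteq\mathcal{C}_{\sigma,d}$, $\mathcal{P}$ is FO definable on $\mathcal{C}_{\sigma,d}$ if and only if $\mathcal{P}$ can be obtained as a finite union of properties defined by neighbourhood profiles, i.e. there are $k\in\mathbb{N}$, radii $r_1,\dots,r_k\in\mathbb{N}$ and $r_i$-neighbourhood profiles $\rho_i$ of degree $d$ ($1\le i\le k$) such that $\mathcal{P}=\bigcup_{1\le i\le k}\mathcal{P}_{\rho_i}$.
   Context: A relational signature $\sigma=\{R_1,\dots,R_\ell\}$ is a finite set of relation symbols, each $R_i$ with an arity $\mathrm{ar}(R_i)\geq 1$. A $\sigma$-structure $A$ has a finite universe $U(A)$ (possibly empty) and relations $R_i(A)\subseteq U(A)^{\mathrm{ar}(R_i)}$. The degree of $a\in U(A)$ is the number of tuples (over all relations) in $A$ containing $a$; the degree of $A$ is the maximum degree of its elements. $\mathcal{C}_{\sigma,d}$ is the class of all $\sigma$-structures of degree at most $d$. A property $\mathcal{P}\subseteq\mathcal{C}_{\sigma,d}$ is an isomorphism-closed subset. $\mathcal{P}$ is FO definable on $\mathcal{C}_{\sigma,d}$ if there is a first-order sentence $\varphi$ over $\sigma$ (with equality) such that $\mathcal{P}=\{A\in\mathcal{C}_{\sigma,d} : A\models\varphi\}$. The Gaifman graph of $A$ is the undirected graph on $U(A)$ in which two distinct elements are adjacent iff they occur together in some tuple of some relation of $A$; distance in $A$ is distance in the Gaifman graph. For $r\in\mathbb{N}$ and $a\in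 U(A)$, $N_r^A(a)$ is the set of elements at distance at most $r$ from $a$, and $\mathcal{N}_r^A(a)$ is the substructure of $A$ induced by $N_r^A(a)$. An $r$-ball is a pair $(B,b)$ with $B$ a $\sigma$-structure, $b\in U(B)$ and $U(B)=N_r^B(b)$; two $r$-balls are isomorphic if there is an isomorphism of $\sigma$-structures mapping centre to centre. An $r$-type is an isomorphism class of $r$-balls; $a\in U(A)$ has $r$-type $\tau$ if $(\mathcal{N}_r^A(a),a)\in\tau$. Let $n_{d,r,\sigma}$ be the (finite) number of $r$-types of $\sigma$-structures of degree at most $d$, and fix an enumeration $\tau_{d,r,\sigma}^1,\dots,\tau_{d,r,\sigma}^{n_{d,r,\sigma}}$ of them. The $r$-histogram vector $\overline{v}_{d,r,\sigma}(A)$ of $A\in\mathcal{C}_{\sigma,d}$ has $i$-th entry equal to the number of elements of $A$ of $r$-type $\tau_{d,r,\sigma}^i$. Let $\mathfrak{I}=\{[k,l],[k,\infty) : k\le l\in\mathbb{N}\}$, where $\mathbb{N}$ includes $0$. An $r$-neighbourhood profile of degree $d$ is a function $\rho:\{1,\dots,n_{d,r,\sigma}\}\to\mathfrak{I}$. The property it defines is $\mathcal{P}_\rho=\{A\in\mathcal{C}_{\sigma,d} : (\overline{v}_{d,r,\sigma}(A))_i\in\rho(i)\text{ for all }1\le i\le n_{d,r,\sigma}\}$. *)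

theory Defs
  imports "HOL-Library.FuncSet" "HOL-Library.Extended_Nat" "HOL-Library.Infinite_Typeclass"
begin

section \<open>Relational structures of bounded degree\<close>

text \<open>Symbols are drawn from an arbitrary type; only those in \<open>syms\<close> belong to the signature.\<close>

record 'r signature =
  syms :: "'r set"
  arity :: "'r \<Rightarrow> nat"

definition relational_signature :: "'r signature \<Rightarrow> bool" where
  "relational_signature \<sigma> \<longleftrightarrow> finite (syms \<sigma>) \<and> (\<forall>R\<in>syms \<sigma>. 1 \<le> arity \<sigma> R)"

record ('r, 'a) rel_structure =
  univ :: "'a set"
  rel :: "'r \<Rightarrow> 'a list set"

text \<open>
  Tuples are lists of the correct length. Symbols outside the signature are interpreted as empty,
  so that two structures over \<open>\<sigma>\<close> are equal iff they have the same universe and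
  interpret every symbol of \<open>\<sigma>\<close> in the same way. Universes are finite subsets of a type \<open>'a\<close>,
  which is infinite wherever this matters, so every finite structure has an isomorphic copy over
  \<open>'a\<close>.
\<close>

definition structures :: "'r signature \<Rightarrow> ('r, 'a) rel_structure set" where
  "structures \<sigma> = {A. finite (univ A)
     \<and> (\<forall>R\<in>syms \<sigma>. rel A R \<subseteq> {t. length t = arity \<sigma> R \<and> set t \<subseteq> univ A})
     \<and> (\<forall>R. R \<notin> syms \<sigma> \<longrightarrow> rel A R = {})}"

definition elem_degree :: "'r signature \<Rightarrow> ('r, 'a) rel_structure \<Rightarrow> 'a \<Rightarrow> nat" where
  "elem_degree \<sigma> A a = card {(R, t). R \<in> syms \<sigma> \<and> t \<in> rel A R \<and> a \<in> set t}"

text \<open>Inserting \<open>0\<close> gives the structure with empty universe degree \<open>0\<close>.\<close>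

definition degree :: "'r signature \<Rightarrow> ('r, 'a) rel_structure \<Rightarrow> nat" where
  "degree \<sigma> A = Max (insert 0 (elem_degree \<sigma> A ` univ A))"

definition bounded_structures :: "'r signature \<Rightarrow> nat \<Rightarrow> ('r, 'a) rel_structure set" where
  "bounded_structures \<sigma> d = {A \<in> structures \<sigma>. degree \<sigma> A \<le> d}"

definition struct_iso ::
  "'r signature \<Rightarrow> ('r, 'a) rel_structure \<Rightarrow> ('r, 'b) rel_structure \<Rightarrow> ('a \<Rightarrow> 'b) \<Rightarrow> bool" where
  "struct_iso \<sigma> A B f \<longleftrightarrow> bij_betw f (univ A) (univ B)
     \<and> (\<forall>R\<in>syms \<sigma>. \<forall>t\<in>lists (univ A). t \<in> rel A R \<longleftrightarrow> map f t \<in> rel B R)"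

definition is_property :: "'r signature \<Rightarrow> nat \<Rightarrow> ('r, 'a) rel_structure set \<Rightarrow> bool" where
  "is_property \<sigma> d P \<longleftrightarrow> P \<subseteq> bounded_structures \<sigma> d
     \<and> (\<forall>A\<in>P. \<forall>B\<in>structures \<sigma>. (\<exists>f. struct_iso \<sigma> A B f) \<longrightarrow> B \<in> P)"

section \<open>First-order logic with equality\<close>

datatype 'r fo =
    Eq nat nat
  | Atom 'r "nat list"
  | Neg "'r fo"
  | Conj "'r fo" "'r fo"
  | Exists nat "'r fo"

primrec free_vars :: "'r fo \<Rightarrow> nat set" where
  "free_vars (Eq x y) = {x, y}"
| "free_vars (Atom R xs) = set xs"
| "free_vars (Neg \<phi>) = free_vars \<phi>"
| "free_vars (Conj \<phi> \<psi>) = free_vars \<phi> \<union> free_vars \<psi>"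
| "free_vars (Exists x \<phi>) = free_vars \<phi> - {x}"

primrec fo_over :: "'r signature \<Rightarrow> 'r fo \<Rightarrow> bool" where
  "fo_over \<sigma> (Eq x y) \<longleftrightarrow> True"
| "fo_over \<sigma> (Atom R xs) \<longleftrightarrow> R \<in> syms \<sigma> \<and> length xs = arity \<sigma> R"
| "fo_over \<sigma> (Neg \<phi>) \<longleftrightarrow> fo_over \<sigma> \<phi>"
| "fo_over \<sigma> (Conj \<phi> \<psi>) \<longleftrightarrow> fo_over \<sigma> \<phi> \<and> fo_over \<sigma> \<psi>"
| "fo_over \<sigma> (Exists x \<phi>) \<longleftrightarrow> fo_over \<sigma> \<phi>"

definition fo_sentence :: "'r signature \<Rightarrow> 'r fo \<Rightarrow> bool" where
  "fo_sentence \<sigma> \<phi> \<longleftrightarrow> fo_over \<sigma> \<phi> \<and> free_vars \<phi> = {}"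

primrec sat :: "('r, 'a) rel_structure \<Rightarrow> (nat \<Rightarrow> 'a) \<Rightarrow> 'r fo \<Rightarrow> bool" where
  "sat A v (Eq x y) \<longleftrightarrow> v x = v y"
| "sat A v (Atom R xs) \<longleftrightarrow> map v xs \<in> rel A R"
| "sat A v (Neg \<phi>) \<longleftrightarrow> \<not> sat A v \<phi>"
| "sat A v (Conj \<phi> \<psi>) \<longleftrightarrow> sat A v \<phi> \<and> sat A v \<psi>"
| "sat A v (Exists x \<phi>) \<longleftrightarrow> (\<exists>a\<in>univ A. sat A (v(x := a)) \<phi>)"

text \<open>
  Only used for sentences, whose truth value does not depend on the valuation. Valuations are not
  restricted to the universe, since none would exist if it is empty.
\<close>

definition models :: "('r, 'a) rel_structure \<Rightarrow> 'r fo \<Rightarrow> bool" (infix "\<Turnstile>" 50) where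
  "A \<Turnstile> \<phi> \<longleftrightarrow> (\<forall>v. sat A v \<phi>)"

definition fo_definable :: "'r signature \<Rightarrow> nat \<Rightarrow> ('r, 'a) rel_structure set \<Rightarrow> bool" where
  "fo_definable \<sigma> d P \<longleftrightarrow>
     (\<exists>\<phi>. fo_sentence \<sigma> \<phi> \<and> P = {A \<in> bounded_structures \<sigma> d. A \<Turnstile> \<phi>})"

section \<open>Neighbourhoods and types\<close>

definition gaifman :: "'r signature \<Rightarrow> ('r, 'a) rel_structure \<Rightarrow> 'a rel" where
  "gaifman \<sigma> A = {(a, b). a \<in> univ A \<and> b \<in> univ A \<and> a \<noteq> b
     \<and> (\<exists>R\<in>syms \<sigma>. \<exists>t\<in>rel A R. a \<in> set t \<and> b \<in> set t)}"

text \<open>The least length of a walk in the Gaifman graph, and \<open>\<infinity>\<close> if there is none.\<close>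

definition gaifman_dist :: "'r signature \<Rightarrow> ('r, 'a) rel_structure \<Rightarrow> 'a \<Rightarrow> 'a \<Rightarrow> enat" where
  "gaifman_dist \<sigma> A a b = Inf (enat ` {n. (a, b) \<in> gaifman \<sigma> A ^^ n})"

definition nbhd :: "'r signature \<Rightarrow> nat \<Rightarrow> ('r, 'a) rel_structure \<Rightarrow> 'a \<Rightarrow> 'a set" where
  "nbhd \<sigma> r A a = {b \<in> univ A. gaifman_dist \<sigma> A a b \<le> enat r}"

definition induced :: "('r, 'a) rel_structure \<Rightarrow> 'a set \<Rightarrow> ('r, 'a) rel_structure" where
  "induced A S = \<lparr>univ = univ A \<inter> S, rel = (\<lambda>R. {t \<in> rel A R. set t \<subseteq> S})\<rparr>"

definition balls :: "'r signature \<Rightarrow> nat \<Rightarrow> (('r, 'a) rel_structure \<times> 'a) set" where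
  "balls \<sigma> r = {(B, b). B \<in> structures \<sigma> \<and> b \<in> univ B \<and> univ B = nbhd \<sigma> r B b}"

definition ball_iso :: "'r signature \<Rightarrow> nat \<Rightarrow> (('r, 'a) rel_structure \<times> 'a) rel" where
  "ball_iso \<sigma> r = {((B, b), (C, c)). (B, b) \<in> balls \<sigma> r \<and> (C, c) \<in> balls \<sigma> r
     \<and> (\<exists>f. struct_iso \<sigma> B C f \<and> f b = c)}"

definition r_types :: "'r signature \<Rightarrow> nat \<Rightarrow> (('r, 'a) rel_structure \<times> 'a) set set" where
  "r_types \<sigma> r = balls \<sigma> r // ball_iso \<sigma> r"

definition has_r_type ::
  "'r signature \<Rightarrow> nat \<Rightarrow> ('r, 'a) rel_structure \<Rightarrow> 'a
    \<Rightarrow> (('r, 'a) rel_structure \<times> 'a) set \<Rightarrow> bool" where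
  "has_r_type \<sigma> r A a \<tau> \<longleftrightarrow> (induced A (nbhd \<sigma> r A a), a) \<in> \<tau>"

definition bounded_r_types ::
  "'r signature \<Rightarrow> nat \<Rightarrow> nat \<Rightarrow> (('r, 'a) rel_structure \<times> 'a) set set" where
  "bounded_r_types \<sigma> d r =
     {\<tau> \<in> r_types \<sigma> r. \<exists>A\<in>bounded_structures \<sigma> d. \<exists>a\<in>univ A. has_r_type \<sigma> r A a \<tau>}"

text \<open>
  The number of types does not depend on the infinite type \<open>'a\<close> of elements; the \<open>itself\<close> argument
  only makes that type explicit.
\<close>

definition num_r_types :: "('r, 'a) rel_structure itself \<Rightarrow> 'r signature \<Rightarrow> nat \<Rightarrow> nat \<Rightarrow> nat" where
  "num_r_types T \<sigma> d r = card (bounded_r_types \<sigma> d r :: (('r, 'a) rel_structure \<times> 'a) set set)"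

text \<open>An enumeration, with indices starting at \<open>1\<close>, fixed once and for all.\<close>

definition r_type_enum ::
  "'r signature \<Rightarrow> nat \<Rightarrow> nat \<Rightarrow> nat \<Rightarrow> (('r, 'a) rel_structure \<times> 'a) set" where
  "r_type_enum \<sigma> d r =
     (SOME e. bij_betw e {1..num_r_types TYPE(('r, 'a) rel_structure) \<sigma> d r} (bounded_r_types \<sigma> d r))"

section \<open>Histograms and neighbourhood profiles\<close>

definition histogram :: "'r signature \<Rightarrow> nat \<Rightarrow> nat \<Rightarrow> ('r, 'a) rel_structure \<Rightarrow> nat \<Rightarrow> nat" where
  "histogram \<sigma> d r A i = card {a \<in> univ A. has_r_type \<sigma> r A a (r_type_enum \<sigma> d r i)}"

definition profile_intervals :: "nat set set" where
  "profile_intervals = {{k..l} | k l. k \<le> l} \<union> {{k..} | k. True}"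

text \<open>Only the values of \<open>\<rho>\<close> at indices of types are relevant.\<close>

definition nbhd_profile ::
  "('r, 'a) rel_structure itself \<Rightarrow> 'r signature \<Rightarrow> nat \<Rightarrow> nat \<Rightarrow> (nat \<Rightarrow> nat set) \<Rightarrow> bool" where
  "nbhd_profile T \<sigma> d r \<rho> \<longleftrightarrow> \<rho> \<in> {1..num_r_types T \<sigma> d r} \<rightarrow> profile_intervals"

definition profile_property ::
  "'r signature \<Rightarrow> nat \<Rightarrow> nat \<Rightarrow> (nat \<Rightarrow> nat set) \<Rightarrow> ('r, 'a) rel_structure set" where
  "profile_property \<sigma> d r \<rho> = {A \<in> bounded_structures \<sigma> d.
     \<forall>i\<in>{1..num_r_types TYPE(('r, 'a) rel_structure) \<sigma> d r}. histogram \<sigma> d r A i \<in> \<rho> i}"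

end

theory Submission
  imports Defs
begin

text \<open>
  The forward direction is Hanf's theorem. If two structures of degree at most \<open>d\<close> have the same
  number of elements of each \<open>r\<close>-type up to a threshold \<open>t\<close>, then a local isomorphism around a few
  elements extends to one more element, at the cost of shrinking the radius from \<open>3 n + 1\<close> to \<open>n\<close>:
  an element close to the chosen ones is mapped by the isomorphism itself, and for a distant one
  the counts provide a distant partner of the same type. Hence, for \<open>r\<close> and \<open>t\<close> large enough, the
  truncated histogram decides a sentence of quantifier rank \<open>q\<close>; there are finitely many truncated
  histograms, each of which is a profile. For the converse, a ball is finite, so its type is
  described by a first-order formula, and so is the presence of at least \<open>k\<close> elements of that type.
\<close>

section \<open>Neighbourhoods of sets of elements\<close>

text \<open>The radius splits as \<open>3 * n + 1 = (2 * n + 1) + n\<close>. Beyond distance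
  \<open>2 * n + 1\<close> two \<open>n\<close>-neighbourhoods are disjoint and no tuple meets both,
  so isomorphisms on them can be glued; within that distance the remaining \<open>n\<close> keeps
  the neighbourhood of the new element inside the domain of the given isomorphism. The obstacle is
  that all partners of the right type might lie near the image. A local isomorphism preserves types
  near its centres, so this is excluded by counting, provided that the threshold exceeds the number
  of near elements. Here the degree bound enters: the neighbourhoods of at most \<open>q\<close>
  centres have bounded size, uniformly over all structures. Types are isomorphism classes of induced
  balls, which are awkward to extend and restrict. The argument therefore works with partial maps
  between the ambient structures, and the classes are translated into such maps only when histograms
  are compared.\<close>

definition reach :: "'r signature \<Rightarrow> ('r, 'a) rel_structure \<Rightarrow> nat \<Rightarrow> 'a set \<Rightarrow> 'a set" where
  "reach \<sigma> A n S = ((gaifman \<sigma> A)\<^sup>= ^^ n) `` S"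

lemma sym_gaifman: "sym (gaifman \<sigma> A)"
  by (auto simp: sym_def gaifman_def)

lemma reach_0 [simp]: "reach \<sigma> A 0 S = S"
  by (simp add: reach_def)

lemma reach_empty [simp]: "reach \<sigma> A n {} = {}"
  by (simp add: reach_def)

lemma reach_Suc: "reach \<sigma> A (Suc n) S = (gaifman \<sigma> A)\<^sup>= `` reach \<sigma> A n S"
  by (simp add: reach_def relcomp_Image del: Un_iff Image_Un relcomp_distrib relcomp_distrib2)

lemma reach_add: "reach \<sigma> A (m + n) S = reach \<sigma> A n (reach \<sigma> A m S)"
  by (simp add: reach_def relpow_add relcomp_Image)

lemma reach_mono_set: "S \<subseteq> T \<Longrightarrow> reach \<sigma> A n S \<subseteq> reach \<sigma> A n T"
  by (auto simp: reach_def)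

lemma subset_reach: "S \<subseteq> reach \<sigma> A n S"
  by (induction n) (auto simp: reach_Suc)

text \<open>\<open>reach\<close> iterates the reflexive closure, so walks may idle and
  \<open>n\<close> steps mean at most \<open>n\<close> steps.\<close>

lemma reach_mono: "m \<le> n \<Longrightarrow> S \<subseteq> T \<Longrightarrow> reach \<sigma> A m S \<subseteq> reach \<sigma> A n T"
  by (metis le_add_diff_inverse reach_add reach_mono_set subset_reach subset_trans)

lemma reach_Un: "reach \<sigma> A n (S \<union> T) = reach \<sigma> A n S \<union> reach \<sigma> A n T"
  by (simp add: reach_def Image_Un)

lemma reach_subset_univ:
  assumes "S \<subseteq> univ A"
  shows "reach \<sigma> A n S \<subseteq> univ A"
  using assms by (induction n) (auto simp: reach_Suc gaifman_def)

text \<open>The Gaifman graph is symmetric, so the walk from \<open>a\<close> to \<open>b\<close>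
  can be reversed. This triangle inequality bounds the distance from \<open>S\<close> to
  \<open>a\<close> when their neighbourhoods meet or are linked.\<close>

lemma reach_trans_sym:
  assumes "b \<in> reach \<sigma> A m S" and "b \<in> reach \<sigma> A n {a}"
  shows "a \<in> reach \<sigma> A (m + n) S"
proof -
  have "((gaifman \<sigma> A)\<^sup>= ^^ n)\<inverse> = (gaifman \<sigma> A)\<^sup>= ^^ n"
  proof (induction n)
    case (Suc n)
    have "((gaifman \<sigma> A)\<^sup>= ^^ Suc n)\<inverse> = ((gaifman \<sigma> A)\<^sup>=)\<inverse> O ((gaifman \<sigma> A)\<^sup>= ^^ n)\<inverse>"
      by (simp only: relpow.simps converse_relcomp)
    also have "\<dots> = (gaifman \<sigma> A)\<^sup>= O (gaifman \<sigma> A)\<^sup>= ^^ n"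
      using Suc sym_gaifman[of \<sigma> A] by (simp only: converse_Un converse_Id sym_conv_converse_eq)
    also have "\<dots> = (gaifman \<sigma> A)\<^sup>= ^^ Suc n"
      by (simp only: relpow.simps relpow_commute)
    finally show ?case .
  qed simp
  then have "a \<in> reach \<sigma> A n {b}"
    using assms(2) by (auto simp: reach_def)
  then show ?thesis
    using assms(1) reach_mono_set[of "{b}" "reach \<sigma> A m S" \<sigma> A n] by (auto simp: reach_add)
qed

lemma structures_tupleD:
  assumes "A \<in> structures \<sigma>" and "t \<in> rel A R"
  shows "R \<in> syms \<sigma>" and "length t = arity \<sigma> R" and "set t \<subseteq> univ A"
  using assms by (auto simp: structures_def)

lemma tuple_subset_reach:
  assumes "A \<in> structures \<sigma>" and "t \<in> rel A R" and "x \<in> set t" and "x \<in> reach \<sigma> A n S"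
  shows "set t \<subseteq> reach \<sigma> A (Suc n) S"
proof
  fix y assume "y \<in> set t"
  then have "(x, y) \<in> (gaifman \<sigma> A)\<^sup>="
    using assms(2,3) structures_tupleD[OF assms(1,2)] by (auto simp: gaifman_def)
  then show "y \<in> reach \<sigma> A (Suc n) S"
    using assms(4) by (auto simp: reach_Suc)
qed

lemma gaifman_reflclE:
  assumes "A \<in> structures \<sigma>" and "(x, y) \<in> (gaifman \<sigma> A)\<^sup>="
  obtains "x = y" | R t where "R \<in> syms \<sigma>" "t \<in> rel A R" "x \<in> set t" "y \<in> set t"
  using assms by (auto simp: gaifman_def)

section \<open>Gaifman distance in terms of iterated steps\<close>

lemma relpow_reflcl_iff: "(a, b) \<in> R\<^sup>= ^^ r \<longleftrightarrow> (\<exists>n\<le>r. (a, b) \<in> R ^^ n)"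
proof (induction r arbitrary: b)
  case (Suc r)
  have "(\<exists>n\<le>Suc r. (a, b) \<in> R ^^ n) \<longleftrightarrow> (\<exists>n\<le>r. (a, b) \<in> R ^^ n) \<or> (\<exists>n\<le>r. (a, b) \<in> R ^^ Suc n)"
    (is "?l \<longleftrightarrow> ?r")
  proof
    assume ?l
    then obtain n where n: "n \<le> Suc r" "(a, b) \<in> R ^^ n" by blast
    then show ?r by (cases n) (auto intro: exI[of _ 0] simp del: relpow.simps(2))
  next
    assume ?r
    then show ?l by (meson Suc_le_mono le_SucI)
  qed
  moreover have "(a, b) \<in> R\<^sup>= ^^ Suc r \<longleftrightarrow> (a, b) \<in> R\<^sup>= ^^ r \<or> (\<exists>c. (a, c) \<in> R\<^sup>= ^^ r \<and> (c, b) \<in> R)"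
    by auto
  moreover have "(\<exists>n\<le>r. (a, b) \<in> R ^^ Suc n) \<longleftrightarrow> (\<exists>c. (\<exists>n\<le>r. (a, c) \<in> R ^^ n) \<and> (c, b) \<in> R)"
    by auto
  ultimately show ?case
    unfolding Suc by blast
qed auto

lemma gaifman_dist_le_iff:
  "gaifman_dist \<sigma> A a b \<le> enat r \<longleftrightarrow> (\<exists>n\<le>r. (a, b) \<in> gaifman \<sigma> A ^^ n)"
proof
  let ?X = "enat ` {n. (a, b) \<in> gaifman \<sigma> A ^^ n}"
  assume le: "gaifman_dist \<sigma> A a b \<le> enat r"
  \<comment> \<open>The infimum of the empty set is \<infinity>, which exceeds
    \<open>enat r\<close>. For a non-empty set it is attained, as \<open>enat\<close> is
    well-ordered.\<close>
  then have "?X \<noteq> {}"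
    by (metis (no_types) Inf_enat_def enat_ord_code(5) gaifman_dist_def)
  then have "Inf ?X \<in> ?X"
    unfolding Inf_enat_def by (auto intro: LeastI)
  then show "\<exists>n\<le>r. (a, b) \<in> gaifman \<sigma> A ^^ n"
    using le by (auto simp: gaifman_dist_def)
next
  assume "\<exists>n\<le>r. (a, b) \<in> gaifman \<sigma> A ^^ n"
  then obtain n where "n \<le> r" "(a, b) \<in> gaifman \<sigma> A ^^ n"
    by blast
  then show "gaifman_dist \<sigma> A a b \<le> enat r"
    unfolding gaifman_dist_def by (auto intro: Inf_lower2[of "enat n"])
qed

lemma mem_nbhd_iff: "b \<in> nbhd \<sigma> r A a \<longleftrightarrow> b \<in> univ A \<and> (a, b) \<in> (gaifman \<sigma> A)\<^sup>= ^^ r"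
  by (simp add: nbhd_def gaifman_dist_le_iff relpow_reflcl_iff)

lemma nbhd_eq_reach:
  assumes "a \<in> univ A"
  shows "nbhd \<sigma> r A a = reach \<sigma> A r {a}"
  using assms reach_subset_univ[of "{a}" A \<sigma> r] by (auto simp: mem_nbhd_iff reach_def)

section \<open>Local isomorphisms\<close>

text \<open>
  The fourth clause is only an inclusion, and the reverse one is automatic; so a bijection onto a
  whole structure is trivially a local isomorphism as soon as it preserves the relations.
\<close>

definition local_iso ::
  "'r signature \<Rightarrow> ('r, 'a) rel_structure \<Rightarrow> ('r, 'b) rel_structure \<Rightarrow> nat \<Rightarrow> 'a set \<Rightarrow> ('a \<Rightarrow> 'b) \<Rightarrow> bool"
where
  "local_iso \<sigma> A B n S f \<longleftrightarrow> S \<subseteq> univ A \<and> f ` S \<subseteq> univ B \<and> inj_on f (reach \<sigma> A n S)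
     \<and> reach \<sigma> B n (f ` S) \<subseteq> f ` reach \<sigma> A n S
     \<and> (\<forall>R\<in>syms \<sigma>. \<forall>t\<in>lists (reach \<sigma> A n S). t \<in> rel A R \<longleftrightarrow> map f t \<in> rel B R)"

lemma local_iso_rel:
  assumes "local_iso \<sigma> A B n S f" and "R \<in> syms \<sigma>" and "set t \<subseteq> reach \<sigma> A n S"
  shows "t \<in> rel A R \<longleftrightarrow> map f t \<in> rel B R"
  using assms unfolding local_iso_def by (metis in_listsI subsetD)

text \<open>A tuple joining a point of \<open>X\<close> to a neighbour stays within
  \<open>m + 1 \<le> n\<close> steps of the centres, so it can be carried to \<open>B\<close>, and
  tuples of \<open>B\<close> can be pulled back. The inclusion assumed at radius \<open>m\<close>
  comes from the induction over radii in \<open>local_iso_image_reach\<close>.\<close>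

lemma local_iso_image_Suc:
  assumes A: "A \<in> structures \<sigma>" and B: "B \<in> structures \<sigma>"
    and iso: "local_iso \<sigma> A B n S f"
    and X: "X \<subseteq> reach \<sigma> A m S" "f ` reach \<sigma> A m S \<subseteq> reach \<sigma> B m (f ` S)" "Suc m \<le> n"
  shows "f ` reach \<sigma> A (Suc 0) X = reach \<sigma> B (Suc 0) (f ` X)"
proof -
  let ?N = "reach \<sigma> A n S"
  have rel: "t \<in> rel A R \<longleftrightarrow> map f t \<in> rel B R" if "R \<in> syms \<sigma>" "set t \<subseteq> ?N" for t R
    using that by (rule local_iso_rel[OF iso])
  have mono: "reach \<sigma> A (Suc m) S \<subseteq> ?N"
    using X(3) by (rule reach_mono) simp
  show ?thesis
  proof (intro equalityI subsetI)
    fix w assume "w \<in> f ` reach \<sigma> A (Suc 0) X"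
    then obtain x y where xy: "x \<in> X" "(x, y) \<in> (gaifman \<sigma> A)\<^sup>=" "w = f y"
      by (auto simp: reach_Suc)
    from A xy(2) show "w \<in> reach \<sigma> B (Suc 0) (f ` X)"
    proof (cases rule: gaifman_reflclE)
      case 1
      then show ?thesis using xy by (auto simp: reach_Suc)
    next
      case (2 R t)
      have "set t \<subseteq> ?N"
        using tuple_subset_reach[OF A 2(2,3)] xy(1) X(1) mono by blast
      then have "map f t \<in> rel B R"
        using rel 2 by blast
      then show ?thesis
        using tuple_subset_reach[OF B, of "map f t" R "f x" 0 "f ` X"] 2 xy by auto
    qed
  next
    fix w assume "w \<in> reach \<sigma> B (Suc 0) (f ` X)"
    then obtain x where x: "x \<in> X" "(f x, w) \<in> (gaifman \<sigma> B)\<^sup>="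
      by (auto simp: reach_Suc)
    from B x(2) show "w \<in> f ` reach \<sigma> A (Suc 0) X"
    proof (cases rule: gaifman_reflclE)
      case 1
      then show ?thesis using x subset_reach[of X \<sigma> A "Suc 0"] by blast
    next
      case (2 R t)
      have "f x \<in> reach \<sigma> B m (f ` S)"
        using x(1) X(1,2) by blast
      then have "set t \<subseteq> reach \<sigma> B n (f ` S)"
        using tuple_subset_reach[OF B 2(2,3)] reach_mono[OF X(3), of "f ` S" "f ` S" \<sigma> B] by blast
      then have "set t \<subseteq> f ` ?N"
        using iso unfolding local_iso_def by blast
      then have "t \<in> map f ` lists ?N"
        unfolding lists_image[symmetric] by blast
      then obtain s where s: "t = map f s" "set s \<subseteq> ?N"
        by blast
      then have sA: "s \<in> rel A R"
        using rel 2 by blast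
      obtain x' y where x': "x' \<in> set s" "f x = f x'" and y: "y \<in> set s" "w = f y"
        using 2(3,4) unfolding s(1) set_map by blast
      \<comment> \<open>The preimage list \<open>s\<close> contains some \<open>x'\<close> with
        \<open>f x' = f x\<close>; injectivity on \<open>?N\<close> identifies it with
        \<open>x\<close>.\<close>
      have "x \<in> ?N"
        using x(1) X reach_mono[of m n S S \<sigma> A] by auto
      moreover have "inj_on f ?N"
        using iso by (simp add: local_iso_def)
      ultimately have "x = x'"
        using x' s(2) by (auto dest: inj_onD)
      then show ?thesis
        using tuple_subset_reach[OF A sA x'(1), of 0 X] x(1) y by auto
    qed
  qed
qed

lemma local_iso_image_reach:
  assumes A: "A \<in> structures \<sigma>" and B: "B \<in> structures \<sigma>"
    and iso: "local_iso \<sigma> A B n S f"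
    and X: "X \<subseteq> reach \<sigma> A m S" "m + k \<le> n"
  shows "f ` reach \<sigma> A k X = reach \<sigma> B k (f ` X)"
proof -
  \<comment> \<open>The case of the centres comes first: at radius \<open>m + k\<close> it supplies
    the inclusion required by the step for a general \<open>X\<close>.\<close>
  have S: "f ` reach \<sigma> A k S = reach \<sigma> B k (f ` S)" if "k \<le> n" for k
    using that
  proof (induction k)
    case (Suc k)
    have "f ` reach \<sigma> A (Suc 0) (reach \<sigma> A k S) = reach \<sigma> B (Suc 0) (f ` reach \<sigma> A k S)"
      using Suc by (intro local_iso_image_Suc[OF A B iso]) auto
    then show ?case
      using Suc by (simp flip: reach_add)
  qed simp
  show ?thesis
    using X(2)
  proof (induction k)
    case (Suc k)
    have "reach \<sigma> A k X \<subseteq> reach \<sigma> A (m + k) S"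
      using X(1) by (auto simp: reach_add intro: reach_mono_set[THEN subsetD])
    then have "f ` reach \<sigma> A (Suc 0) (reach \<sigma> A k X) = reach \<sigma> B (Suc 0) (f ` reach \<sigma> A k X)"
      using Suc.prems S[of "m + k"] by (intro local_iso_image_Suc[OF A B iso]) auto
    then show ?case
      using Suc by (simp flip: reach_add)
  qed simp
qed

lemma local_iso_image:
  assumes "A \<in> structures \<sigma>" and "B \<in> structures \<sigma>" and "local_iso \<sigma> A B n S f"
  shows "f ` reach \<sigma> A n S = reach \<sigma> B n (f ` S)"
  using local_iso_image_reach[OF assms, of S 0 n] by simp

text \<open>Used with \<open>m = 0\<close> to shrink the radius or drop centres, and with larger
  \<open>m\<close> to move the centre to a nearby element. The condition
  \<open>m + k \<le> n\<close> keeps the \<open>k\<close>-neighbourhood of \<open>X\<close> in the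
  domain.\<close>

lemma local_iso_restrict:
  assumes A: "A \<in> structures \<sigma>" and B: "B \<in> structures \<sigma>"
    and iso: "local_iso \<sigma> A B n S f"
    and X: "X \<subseteq> reach \<sigma> A m S" "m + k \<le> n"
  shows "local_iso \<sigma> A B k X f"
proof -
  have "reach \<sigma> A k X \<subseteq> reach \<sigma> A (m + k) S"
    using X(1) by (simp add: reach_add reach_mono_set)
  also have "\<dots> \<subseteq> reach \<sigma> A n S"
    using X(2) by (rule reach_mono) simp
  finally have sub: "reach \<sigma> A k X \<subseteq> reach \<sigma> A n S" .
  have "f ` X \<subseteq> reach \<sigma> B n (f ` S)"
    using sub subset_reach[of X \<sigma> A k] local_iso_image[OF A B iso] by blast
  then have "f ` X \<subseteq> univ B"
    using iso reach_subset_univ[of "f ` S" B \<sigma> n] by (auto simp: local_iso_def)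
  moreover have "X \<subseteq> univ A"
    using iso X(1) reach_subset_univ[of S A \<sigma> m] by (auto simp: local_iso_def)
  moreover have "inj_on f (reach \<sigma> A k X)"
    using iso sub by (auto simp: local_iso_def intro: inj_on_subset)
  moreover have "lists (reach \<sigma> A k X) \<subseteq> lists (reach \<sigma> A n S)"
    using sub by (rule lists_mono)
  ultimately show ?thesis
    using iso local_iso_image_reach[OF A B iso X] unfolding local_iso_def by (simp add: subset_iff)
qed

lemma local_iso_refl: "S \<subseteq> univ A \<Longrightarrow> local_iso \<sigma> A A n S id"
  by (simp add: local_iso_def)

text \<open>By \<open>local_iso_image\<close>, \<open>f\<close> maps its neighbourhood onto the full
  neighbourhood in \<open>B\<close>; this makes the notion symmetric although its fourth clause is
  one-sided.\<close>

lemma local_iso_sym: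
  assumes A: "A \<in> structures \<sigma>" and B: "B \<in> structures \<sigma>" and iso: "local_iso \<sigma> A B n S f"
  shows "local_iso \<sigma> B A n (f ` S) (inv_into (reach \<sigma> A n S) f)"
proof -
  let ?N = "reach \<sigma> A n S" and ?g = "inv_into (reach \<sigma> A n S) f"
  have img: "f ` ?N = reach \<sigma> B n (f ` S)"
    by (rule local_iso_image[OF A B iso])
  have inj: "inj_on f ?N"
    using iso by (simp add: local_iso_def)
  have gf: "?g ` f ` X = X" if "X \<subseteq> ?N" for X
    using inj that by (simp add: inv_into_image_cancel)
  have fg: "map f (map ?g t) = t" if "set t \<subseteq> f ` ?N" for t
    using that unfolding map_map by (intro map_idI) (auto simp: f_inv_into_f)
  have "t \<in> rel B R \<longleftrightarrow> map ?g t \<in> rel A R" if "R \<in> syms \<sigma>" "set t \<subseteq> f ` ?N" for t R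
  proof -
    have "set (map ?g t) \<subseteq> ?N"
      using that(2) gf[of ?N] by auto
    then show ?thesis
      using local_iso_rel[OF iso that(1)] fg[OF that(2)] by metis
  qed
  then show ?thesis
    using iso gf[of S] gf[of ?N] subset_reach[of S \<sigma> A n] img inj_on_inv_into[of "f ` ?N" f ?N]
    unfolding local_iso_def by (auto simp: in_lists_conv_set subset_iff)
qed

lemma local_iso_trans:
  assumes A: "A \<in> structures \<sigma>" and B: "B \<in> structures \<sigma>"
    and f: "local_iso \<sigma> A B n S f" and g: "local_iso \<sigma> B C n (f ` S) g"
  shows "local_iso \<sigma> A C n S (g \<circ> f)"
proof -
  have img: "f ` reach \<sigma> A n S = reach \<sigma> B n (f ` S)"
    by (rule local_iso_image[OF A B f])
  have "t \<in> rel A R \<longleftrightarrow> map (g \<circ> f) t \<in> rel C R"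
    if "R \<in> syms \<sigma>" "t \<in> lists (reach \<sigma> A n S)" for R t
  proof -
    have "map f t \<in> lists (reach \<sigma> B n (f ` S))"
      using that(2) unfolding img[symmetric] by auto
    then show ?thesis
      using f g that unfolding local_iso_def by (metis map_map)
  qed
  moreover have "reach \<sigma> C n ((g \<circ> f) ` S) \<subseteq> (g \<circ> f) ` reach \<sigma> A n S"
    using g unfolding local_iso_def image_comp[symmetric] img by simp
  ultimately show ?thesis
    using f g img comp_inj_on[of f _ g] unfolding local_iso_def image_comp[symmetric] by auto
qed

section \<open>Gluing local isomorphisms with distant centres\<close>

lemma reach_far_disjoint:
  assumes "a \<notin> reach \<sigma> A (2 * n + 1) S"
  shows "reach \<sigma> A n S \<inter> reach \<sigma> A n {a} = {}"
proof -
  have "a \<notin> reach \<sigma> A (n + n) S"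
    using assms reach_mono[of "n + n" "2 * n + 1" S S \<sigma> A] by auto
  then show ?thesis
    using reach_trans_sym[of _ \<sigma> A n S n a] by blast
qed

text \<open>A tuple meeting both neighbourhoods would give a walk of \<open>n + 1 + n\<close> steps
  from \<open>S\<close> to \<open>a\<close>; the middle step is the \<open>+ 1\<close> in
  \<open>2 * n + 1\<close>.\<close>

lemma far_tuple_cases:
  assumes A: "A \<in> structures \<sigma>" and far: "a \<notin> reach \<sigma> A (2 * n + 1) S"
    and t: "t \<in> rel A R" "set t \<subseteq> reach \<sigma> A n S \<union> reach \<sigma> A n {a}"
  obtains "set t \<subseteq> reach \<sigma> A n S" | "set t \<subseteq> reach \<sigma> A n {a}"
proof (rule ccontr)
  assume "\<not> thesis"
  then have "\<not> set t \<subseteq> reach \<sigma> A n S" "\<not> set t \<subseteq> reach \<sigma> A n {a}"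
    using that by blast+
  then obtain x y where xy: "x \<in> set t" "x \<in> reach \<sigma> A n S" "y \<in> set t" "y \<in> reach \<sigma> A n {a}"
    using t(2) by blast
  then have "y \<in> reach \<sigma> A (Suc n) S"
    using tuple_subset_reach[OF A t(1)] by blast
  then have "a \<in> reach \<sigma> A (Suc n + n) S"
    using xy(4) by (rule reach_trans_sym)
  then show False
    using far by (simp add: mult_2)
qed

text \<open>
  If \<open>a\<close> and \<open>g a\<close> are too far from \<open>S\<close> and \<open>f ` S\<close> for their neighbourhoods to meet or to be linked
  by a tuple, then \<open>f\<close> and \<open>g\<close> can be glued.
\<close>

lemma local_iso_insert_far:
  assumes A: "A \<in> structures \<sigma>" and B: "B \<in> structures \<sigma>"
    and f: "local_iso \<sigma> A B n S f" and g: "local_iso \<sigma> A B n {a} g"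
    and farA: "a \<notin> reach \<sigma> A (2 * n + 1) S" and farB: "g a \<notin> reach \<sigma> B (2 * n + 1) (f ` S)"
  shows "local_iso \<sigma> A B n (insert a S) (\<lambda>x. if x \<in> reach \<sigma> A n S then f x else g x)"
proof -
  define h where "h = (\<lambda>x. if x \<in> reach \<sigma> A n S then f x else g x)"
  let ?X = "reach \<sigma> A n S" and ?Y = "reach \<sigma> A n {a}"
  let ?X' = "reach \<sigma> B n (f ` S)" and ?Y' = "reach \<sigma> B n {g a}"
  have disjA: "?X \<inter> ?Y = {}"
    by (rule reach_far_disjoint[OF farA])
  have disjB: "?X' \<inter> ?Y' = {}"
    by (rule reach_far_disjoint[OF farB])
  have XY: "reach \<sigma> A n (insert a S) = ?X \<union> ?Y"
    using reach_Un[of \<sigma> A n S "{a}"] by simp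
  have hX: "h x = f x" if "x \<in> ?X" for x
    using that by (simp add: h_def)
  have hY: "h x = g x" if "x \<in> ?Y" for x
    using that disjA by (auto simp: h_def)
  have imX: "h ` ?X = ?X'" and imY: "h ` ?Y = ?Y'"
    using local_iso_image[OF A B f] local_iso_image[OF A B g]
      image_cong[OF refl hX, of ?X] image_cong[OF refl hY, of ?Y] by simp_all
  have hS: "h ` S = f ` S" "h a = g a"
    using image_cong[OF refl hX[OF subsetD[OF subset_reach]], of S]
      hY[OF subsetD[OF subset_reach], of a] by simp_all
  have "reach \<sigma> B n (h ` insert a S) = ?X' \<union> ?Y'"
    using reach_Un[of \<sigma> B n "{g a}" "f ` S"] by (simp add: hS Un_commute)
  then have img: "reach \<sigma> B n (h ` insert a S) \<subseteq> h ` reach \<sigma> A n (insert a S)"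
    by (simp only: XY image_Un imX imY)
  have inj: "inj_on h (?X \<union> ?Y)"
  proof -
    have "inj_on h ?X" "inj_on h ?Y"
      using f g hX hY inj_on_cong[of ?X h f] inj_on_cong[of ?Y h g] by (auto simp: local_iso_def)
    then show ?thesis
      using disjB imX imY unfolding inj_on_Un by blast
  qed
  have mapX: "map h t = map f t" if "set t \<subseteq> ?X" for t
    by (intro map_cong refl hX subsetD[OF that])
  have mapY: "map h t = map g t" if "set t \<subseteq> ?Y" for t
    by (intro map_cong refl hY subsetD[OF that])
  have relX: "t \<in> rel A R \<longleftrightarrow> map h t \<in> rel B R" if "R \<in> syms \<sigma>" "set t \<subseteq> ?X" for t R
    unfolding mapX[OF that(2)] by (rule local_iso_rel[OF f that])
  have relY: "t \<in> rel A R \<longleftrightarrow> map h t \<in> rel B R" if "R \<in> syms \<sigma>" "set t \<subseteq> ?Y" for t R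
    unfolding mapY[OF that(2)] by (rule local_iso_rel[OF g that])
  have "t \<in> rel A R \<longleftrightarrow> map h t \<in> rel B R" if R: "R \<in> syms \<sigma>" and t: "set t \<subseteq> ?X \<union> ?Y" for t R
  proof
    assume "t \<in> rel A R"
    then show "map h t \<in> rel B R"
      using far_tuple_cases[OF A farA _ t] relX[OF R] relY[OF R] by metis
  next
    \<comment> \<open>The tuple is split on the \<open>B\<close> side, and injectivity of
      \<open>h\<close> on the union pulls the case distinction back to \<open>t\<close>.\<close>
    assume hB: "map h t \<in> rel B R"
    have "h ` (?X \<union> ?Y) = ?X' \<union> ?Y'"
      by (simp only: image_Un imX imY)
    then have "set (map h t) \<subseteq> ?X' \<union> ?Y'"
      using t unfolding set_map by (metis image_mono)
    then have "set (map h t) \<subseteq> ?X' \<or> set (map h t) \<subseteq> ?Y'"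
      using far_tuple_cases[OF B farB hB] by metis
    then have "h ` set t \<subseteq> h ` ?X \<or> h ` set t \<subseteq> h ` ?Y"
      unfolding set_map imX imY .
    then have "set t \<subseteq> ?X \<or> set t \<subseteq> ?Y"
      using inj_on_image_mem_iff[OF inj, of _ ?X] inj_on_image_mem_iff[OF inj, of _ ?Y] t by blast
    then show "t \<in> rel A R"
      using relX[OF R] relY[OF R] hB by metis
  qed
  moreover have "insert a S \<subseteq> univ A" "h ` insert a S \<subseteq> univ B"
    using f g unfolding image_insert hS by (auto simp: local_iso_def)
  ultimately show ?thesis
    using inj img unfolding local_iso_def XY h_def[symmetric] Ball_def in_lists_conv_set by (simp add: subset_iff)
qed

text \<open>Equality of \<open>n\<close>-types across structures, possibly over different element
  types. Formulated without induced balls, it passes to smaller radii by restriction;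
  \<open>has_r_type_same_type\<close> connects it with the classes.\<close>

definition same_type ::
  "'r signature \<Rightarrow> nat \<Rightarrow> ('r, 'a) rel_structure \<Rightarrow> 'a \<Rightarrow> ('r, 'b) rel_structure \<Rightarrow> 'b \<Rightarrow> bool" where
  "same_type \<sigma> n A a B b \<longleftrightarrow> (\<exists>f. local_iso \<sigma> A B n {a} f \<and> f a = b)"

lemma same_type_univ:
  assumes "same_type \<sigma> n A a B b"
  shows "a \<in> univ A" and "b \<in> univ B"
  using assms by (auto simp: same_type_def local_iso_def)

lemma same_type_refl: "a \<in> univ A \<Longrightarrow> same_type \<sigma> n A a A a"
  using local_iso_refl[of "{a}" A \<sigma> n] by (auto simp: same_type_def)

lemma same_type_sym:
  assumes "A \<in> structures \<sigma>" and "B \<in> structures \<sigma>" and "same_type \<sigma> n A a B b"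
  shows "same_type \<sigma> n B b A a"
proof -
  obtain f where f: "local_iso \<sigma> A B n {a} f" "f a = b"
    using assms(3) by (auto simp: same_type_def)
  have "local_iso \<sigma> B A n {b} (inv_into (reach \<sigma> A n {a}) f)"
    using local_iso_sym[OF assms(1,2) f(1)] f(2) by simp
  moreover have "inv_into (reach \<sigma> A n {a}) f b = a"
    using f subset_reach[of "{a}" \<sigma> A n] by (auto simp: local_iso_def)
  ultimately show ?thesis
    by (auto simp: same_type_def)
qed

lemma same_type_trans:
  assumes "A \<in> structures \<sigma>" and "B \<in> structures \<sigma>"
    and "same_type \<sigma> n A a B b" and "same_type \<sigma> n B b C c"
  shows "same_type \<sigma> n A a C c"
proof -
  obtain f g where f: "local_iso \<sigma> A B n {a} f" "f a = b" and g: "local_iso \<sigma> B C n {b} g" "g b = c"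
    using assms(3,4) by (auto simp: same_type_def)
  have "local_iso \<sigma> A C n {a} (g \<circ> f)"
    using local_iso_trans[OF assms(1,2) f(1)] f(2) g(1) by simp
  then show ?thesis
    using f(2) g(2) by (auto simp: same_type_def)
qed

lemma same_type_mono:
  assumes "A \<in> structures \<sigma>" and "B \<in> structures \<sigma>" and "same_type \<sigma> n A a B b" and "m \<le> n"
  shows "same_type \<sigma> m A a B b"
  using assms local_iso_restrict[OF assms(1,2), of n "{a}" _ "{a}" 0 m] by (auto simp: same_type_def)

section \<open>Hanf's theorem\<close>

text \<open>
  Up to the threshold \<open>t\<close>, each \<open>n\<close>-type occurs at least as often in \<open>B\<close> as in \<open>A\<close>. Stated with
  injections instead of cardinalities, this is evidently inherited by smaller radii.
\<close>

definition type_counts_le ::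
  "'r signature \<Rightarrow> nat \<Rightarrow> nat \<Rightarrow> ('r, 'a) rel_structure \<Rightarrow> ('r, 'b) rel_structure \<Rightarrow> bool" where
  "type_counts_le \<sigma> n t A B \<longleftrightarrow>
     (\<forall>F\<subseteq>univ A. card F \<le> t \<longrightarrow> (\<exists>g. inj_on g F \<and> (\<forall>a\<in>F. same_type \<sigma> n A a B (g a))))"

lemma type_counts_le_mono:
  assumes "A \<in> structures \<sigma>" and "B \<in> structures \<sigma>" and "type_counts_le \<sigma> n t A B" and "m \<le> n"
  shows "type_counts_le \<sigma> m t A B"
  using assms(3) same_type_mono[OF assms(1,2) _ assms(4)] unfolding type_counts_le_def by meson

text \<open>
  If every element of \<open>B\<close> of the type of \<open>a\<close> were close to \<open>f ` S\<close>, then \<open>f\<close> would match them with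
  elements close to \<open>S\<close>, and \<open>A\<close> would have one element of this type too many, namely \<open>a\<close>.
\<close>

lemma exists_far_same_type:
  assumes A: "A \<in> structures \<sigma>" and B: "B \<in> structures \<sigma>"
    and iso: "local_iso \<sigma> A B (m + n) S f"
    and a: "a \<in> univ A" "a \<notin> reach \<sigma> A m S"
    and counts: "type_counts_le \<sigma> n t A B" and small: "card (reach \<sigma> A m S) < t"
  shows "\<exists>b. same_type \<sigma> n A a B b \<and> b \<notin> reach \<sigma> B m (f ` S)"
proof (rule ccontr)
  assume none: "\<not> ?thesis"
  let ?N = "reach \<sigma> A m S"
  define F where "F = {c \<in> ?N. same_type \<sigma> n A c A a}"
  have fin: "finite ?N"
    using iso A reach_subset_univ[of S A \<sigma> m]
    by (auto simp: local_iso_def structures_def intro: finite_subset)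
  then have finF: "finite F" "card F \<le> card ?N" "a \<notin> F" "insert a F \<subseteq> univ A"
    using a same_type_univ by (auto simp: F_def card_mono)
  then have "card (insert a F) \<le> t"
    using small by simp
  then obtain g where g: "inj_on g (insert a F)" "\<And>c. c \<in> insert a F \<Longrightarrow> same_type \<sigma> n A c B (g c)"
    using counts finF(4) unfolding type_counts_le_def by meson
  have "g c \<in> f ` F" if c: "c \<in> insert a F" for c
  proof -
    have "same_type \<sigma> n A a A c"
      using c a(1) same_type_sym[OF A A] same_type_refl by (auto simp: F_def)
    then have ag: "same_type \<sigma> n A a B (g c)"
      using g(2)[OF c] by (rule same_type_trans[OF A A])
    then have "g c \<in> reach \<sigma> B m (f ` S)"
      using none by blast
    then obtain e where e: "e \<in> ?N" "g c = f e"
      using local_iso_image_reach[OF A B iso, of S 0 m] by auto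
    \<comment> \<open>Since \<open>e\<close> is within \<open>m\<close> of \<open>S\<close>, the
      radius \<open>m + n\<close> leaves its whole \<open>n\<close>-neighbourhood in the domain, so
      \<open>f\<close> itself witnesses that \<open>e\<close> and \<open>g c\<close> have the same
      type.\<close>
    have "local_iso \<sigma> A B n {e} f"
      using e(1) by (intro local_iso_restrict[OF A B iso]) auto
    then have "same_type \<sigma> n A e B (g c)"
      using e(2) by (auto simp: same_type_def)
    then have "same_type \<sigma> n A e A a"
      by (rule same_type_trans[OF A B _ same_type_sym[OF A B ag]])
    then show ?thesis
      using e by (auto simp: F_def)
  qed
  then have "card (insert a F) \<le> card F"
    using surj_card_le[of F _ f] card_inj_on_le[OF g(1), of "f ` F"] finF(1) card_image_le[of F f]
    by (metis finite_imageI image_subsetI le_trans)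
  then show False
    using finF by simp
qed

text \<open>Agreement with \<open>f\<close> on \<open>S\<close> is what the induction on formulas
  needs: the values already matched must keep their partners.\<close>

lemma local_iso_extend:
  assumes A: "A \<in> structures \<sigma>" and B: "B \<in> structures \<sigma>"
    and iso: "local_iso \<sigma> A B (3 * n + 1) S f" and a: "a \<in> univ A"
    and counts: "type_counts_le \<sigma> n t A B" and small: "card (reach \<sigma> A (2 * n + 1) S) < t"
  shows "\<exists>h. local_iso \<sigma> A B n (insert a S) h \<and> (\<forall>x\<in>S. h x = f x)"
proof (cases "a \<in> reach \<sigma> A (2 * n + 1) S")
  case True
  then have "local_iso \<sigma> A B n (insert a S) f"
    using subset_reach[of S \<sigma> A "2 * n + 1"] by (intro local_iso_restrict[OF A B iso, of _ "2 * n + 1"]) auto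
  then show ?thesis
    by auto
next
  case False
  have "local_iso \<sigma> A B (2 * n + 1 + n) S f"
    using iso by (simp add: mult_ac)
  then obtain b where b: "same_type \<sigma> n A a B b" "b \<notin> reach \<sigma> B (2 * n + 1) (f ` S)"
    using exists_far_same_type[OF A B _ a False counts small] by blast
  then obtain g where g: "local_iso \<sigma> A B n {a} g" "g a = b"
    by (auto simp: same_type_def)
  have "local_iso \<sigma> A B n S f"
    by (rule local_iso_restrict[OF A B iso, of _ 0]) auto
  then have "local_iso \<sigma> A B n (insert a S) (\<lambda>x. if x \<in> reach \<sigma> A n S then f x else g x)"
    using g b(2) False by (intro local_iso_insert_far[OF A B]) auto
  then show ?thesis
    using subset_reach[of S \<sigma> A n] by (intro exI) auto
qed

text \<open>\<open>W\<close> holds the variables already assigned. Elsewhere the valuations are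
  unconstrained; being total, they may leave the universe.\<close>

definition similar ::
  "'r signature \<Rightarrow> nat \<Rightarrow> nat set \<Rightarrow> ('r, 'a) rel_structure \<Rightarrow> (nat \<Rightarrow> 'a)
    \<Rightarrow> ('r, 'b) rel_structure \<Rightarrow> (nat \<Rightarrow> 'b) \<Rightarrow> bool" where
  "similar \<sigma> n W A v B w \<longleftrightarrow> (\<exists>f. local_iso \<sigma> A B n (v ` W) f \<and> (\<forall>x\<in>W. f (v x) = w x))"

lemma similar_mono:
  assumes "A \<in> structures \<sigma>" and "B \<in> structures \<sigma>" and "similar \<sigma> n W A v B w" and "m \<le> n"
  shows "similar \<sigma> m W A v B w"
  using assms local_iso_restrict[OF assms(1,2), of n "v ` W" _ "v ` W" 0 m] by (auto simp: similar_def)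

lemma similar_sym:
  assumes "A \<in> structures \<sigma>" and "B \<in> structures \<sigma>" and "similar \<sigma> n W A v B w"
  shows "similar \<sigma> n W B w A v"
proof -
  obtain f where f: "local_iso \<sigma> A B n (v ` W) f" "\<And>x. x \<in> W \<Longrightarrow> f (v x) = w x"
    using assms(3) by (auto simp: similar_def)
  let ?g = "inv_into (reach \<sigma> A n (v ` W)) f"
  have "f ` v ` W = w ` W"
    using f(2) by (auto simp: image_iff)
  then have "local_iso \<sigma> B A n (w ` W) ?g"
    using local_iso_sym[OF assms(1,2) f(1)] by simp
  moreover have "?g (w x) = v x" if "x \<in> W" for x
    using f(1) inv_into_f_f[of f _ "v x"] f(2)[OF that] that subset_reach[of "v ` W" \<sigma> A n]
    by (auto simp: local_iso_def)
  ultimately show ?thesis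
    by (auto simp: similar_def)
qed

lemma similar_extend:
  assumes A: "A \<in> structures \<sigma>" and B: "B \<in> structures \<sigma>"
    and sim: "similar \<sigma> (3 * n + 1) W A v B w" and a: "a \<in> univ A"
    and counts: "type_counts_le \<sigma> n t A B" and small: "card (reach \<sigma> A (2 * n + 1) (v ` W)) < t"
  shows "\<exists>b\<in>univ B. similar \<sigma> n (insert x W) A (v(x := a)) B (w(x := b))"
proof -
  obtain f where f: "local_iso \<sigma> A B (3 * n + 1) (v ` W) f" "\<And>y. y \<in> W \<Longrightarrow> f (v y) = w y"
    using sim by (auto simp: similar_def)
  obtain h where h: "local_iso \<sigma> A B n (insert a (v ` W)) h" "\<forall>y\<in>v ` W. h y = f y"
    using local_iso_extend[OF A B f(1) a counts small] by blast
  have "local_iso \<sigma> A B n (v(x := a) ` insert x W) h"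
    by (rule local_iso_restrict[OF A B h(1), of _ 0]) auto
  moreover have "\<forall>y\<in>insert x W. h ((v(x := a)) y) = (w(x := h a)) y"
    using f(2) h(2) by auto
  ultimately have "similar \<sigma> n (insert x W) A (v(x := a)) B (w(x := h a))"
    unfolding similar_def by blast
  moreover have "h a \<in> univ B"
    using h(1) by (auto simp: local_iso_def)
  ultimately show ?thesis
    by blast
qed

lemma finite_reach:
  assumes "A \<in> structures \<sigma>" and "S \<subseteq> univ A"
  shows "finite (reach \<sigma> A n S)"
  using reach_subset_univ[OF assms(2)] assms(1) by (auto simp: structures_def intro: rev_finite_subset)

lemma card_reach_mono:
  assumes "A \<in> structures \<sigma>" and "S \<subseteq> univ A" and "m \<le> n"
  shows "card (reach \<sigma> A m S) \<le> card (reach \<sigma> A n S)"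
  by (intro card_mono finite_reach[OF assms(1,2)] reach_mono[OF assms(3) order_refl])

section \<open>Induction on formulas\<close>

primrec qrank :: "'r fo \<Rightarrow> nat" where
  "qrank (Eq x y) = 0"
| "qrank (Atom R xs) = 0"
| "qrank (Neg \<phi>) = qrank \<phi>"
| "qrank (Conj \<phi> \<psi>) = max (qrank \<phi>) (qrank \<psi>)"
| "qrank (Exists x \<phi>) = Suc (qrank \<phi>)"

text \<open>Accumulates the loss from \<open>3 * n + 1\<close> to \<open>n\<close> over
  \<open>q\<close> quantifiers; the closed form is \<open>(3 ^ q - 1) div 2\<close>.\<close>

primrec hanf_radius :: "nat \<Rightarrow> nat" where
  "hanf_radius 0 = 0"
| "hanf_radius (Suc q) = 3 * hanf_radius q + 1"

lemma hanf_radius_mono: "p \<le> q \<Longrightarrow> hanf_radius p \<le> hanf_radius q"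
  by (rule lift_Suc_mono_le[of hanf_radius]) auto

text \<open>Under a quantifier the rank drops by one and \<open>W\<close> gains at most one
  variable, so \<open>qrank \<phi> + card W \<le> q\<close> is preserved. It bounds the number of
  centres by \<open>q\<close> throughout, which makes the size bounds applicable, while the radius
  of similarity shrinks with the rank.\<close>

lemma similar_sat_iff:
  assumes A: "A \<in> structures \<sigma>" and B: "B \<in> structures \<sigma>"
    and counts: "type_counts_le \<sigma> (hanf_radius q) t A B" "type_counts_le \<sigma> (hanf_radius q) t B A"
    and smallA: "\<And>S. S \<subseteq> univ A \<Longrightarrow> card S \<le> q \<Longrightarrow> card (reach \<sigma> A (hanf_radius q) S) < t"
    and smallB: "\<And>S. S \<subseteq> univ B \<Longrightarrow> card S \<le> q \<Longrightarrow> card (reach \<sigma> B (hanf_radius q) S) < t"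
    and "similar \<sigma> (hanf_radius (qrank \<phi>)) W A v B w"
    and "finite W" and "qrank \<phi> + card W \<le> q" and "free_vars \<phi> \<subseteq> W" and "fo_over \<sigma> \<phi>"
  shows "sat A v \<phi> \<longleftrightarrow> sat B w \<phi>"
  using assms(7-)
proof (induction \<phi> arbitrary: W v w)
  case (Eq x y)
  then obtain f where f: "local_iso \<sigma> A B 0 (v ` W) f" "\<And>y. y \<in> W \<Longrightarrow> f (v y) = w y"
    by (auto simp: similar_def)
  have "inj_on f (v ` W)"
    using f(1) by (simp add: local_iso_def)
  then have "f (v x) = f (v y) \<longleftrightarrow> v x = v y"
    using Eq.prems(4) by (intro inj_on_eq_iff) auto
  then show ?case
    using Eq.prems(4) f(2)[of x] f(2)[of y] by auto
next
  case (Atom R xs)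
  then obtain f where f: "local_iso \<sigma> A B 0 (v ` W) f" "\<And>y. y \<in> W \<Longrightarrow> f (v y) = w y"
    by (auto simp: similar_def)
  have "map f (map v xs) = map w xs"
    using Atom.prems(4) f(2) by auto
  moreover have "set (map v xs) \<subseteq> v ` W"
    using Atom.prems(4) by auto
  ultimately show ?case
    using local_iso_rel[OF f(1), of R "map v xs"] Atom.prems(5) by (simp del: map_map)
next
  case (Neg \<phi>)
  then show ?case by simp
next
  case (Conj \<phi> \<psi>)
  have "similar \<sigma> (hanf_radius (qrank \<phi>)) W A v B w" "similar \<sigma> (hanf_radius (qrank \<psi>)) W A v B w"
    using similar_mono[OF A B Conj.prems(1)] hanf_radius_mono by auto
  then show ?case
    using Conj by simp
next
  case (Exists x \<phi>)
  let ?n = "hanf_radius (qrank \<phi>)"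
  \<comment> \<open>Counts and size bounds are given once, at radius \<open>hanf_radius q\<close>;
    this inequality passes them down to \<open>?n\<close> and \<open>2 * ?n + 1\<close>.\<close>
  have n: "3 * ?n + 1 \<le> hanf_radius q"
    using hanf_radius_mono[of "Suc (qrank \<phi>)" q] Exists.prems(3) by simp
  have sim: "similar \<sigma> (3 * ?n + 1) W A v B w"
    using Exists.prems(1) by simp
  have card: "card (insert x W) \<le> Suc (card W)" "card (v ` W) \<le> q" "card (w ` W) \<le> q"
    using Exists.prems(2,3) card_image_le[of W v] card_image_le[of W w] by (auto simp: card_insert_if)
  have IH: "sat A v' \<phi> \<longleftrightarrow> sat B w' \<phi>" if "similar \<sigma> ?n (insert x W) A v' B w'" for v' w'
    using that card(1) Exists.prems by (intro Exists.IH[of "insert x W"]) auto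
  have univ: "v ` W \<subseteq> univ A" "w ` W \<subseteq> univ B"
    using sim similar_sym[OF A B sim] by (auto simp: similar_def local_iso_def)
  have small: "card (reach \<sigma> A (2 * ?n + 1) (v ` W)) < t" "card (reach \<sigma> B (2 * ?n + 1) (w ` W)) < t"
    using n le_less_trans[OF card_reach_mono[OF A univ(1)] smallA[OF univ(1) card(2)]]
      le_less_trans[OF card_reach_mono[OF B univ(2)] smallB[OF univ(2) card(3)]] by auto
  have counts': "type_counts_le \<sigma> ?n t A B" "type_counts_le \<sigma> ?n t B A"
    using type_counts_le_mono[OF A B counts(1)] type_counts_le_mono[OF B A counts(2)] n by auto
  show ?case
  proof
    assume "sat A v (Exists x \<phi>)"
    then obtain a where "a \<in> univ A" "sat A (v(x := a)) \<phi>"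
      by auto
    then show "sat B w (Exists x \<phi>)"
      using similar_extend[OF A B sim _ counts'(1) small(1), of a x] IH by auto
  next
    assume "sat B w (Exists x \<phi>)"
    then obtain b where b: "b \<in> univ B" "sat B (w(x := b)) \<phi>"
      by auto
    then obtain a where "a \<in> univ A" "similar \<sigma> ?n (insert x W) B (w(x := b)) A (v(x := a))"
      using similar_extend[OF B A similar_sym[OF A B sim] _ counts'(2) small(2), of b x] by blast
    then show "sat A v (Exists x \<phi>)"
      using similar_sym[OF B A, of ?n "insert x W" "w(x := b)" "v(x := a)"] IH b(2) by auto
  qed
qed

lemma hanf:
  assumes "relational_signature \<sigma>" and A: "A \<in> structures \<sigma>" and B: "B \<in> structures \<sigma>"
    and "type_counts_le \<sigma> (hanf_radius (qrank \<phi>)) t A B"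
    and "type_counts_le \<sigma> (hanf_radius (qrank \<phi>)) t B A"
    and "\<And>S. S \<subseteq> univ A \<Longrightarrow> card S \<le> qrank \<phi> \<Longrightarrow> card (reach \<sigma> A (hanf_radius (qrank \<phi>)) S) < t"
    and "\<And>S. S \<subseteq> univ B \<Longrightarrow> card S \<le> qrank \<phi> \<Longrightarrow> card (reach \<sigma> B (hanf_radius (qrank \<phi>)) S) < t"
    and "fo_sentence \<sigma> \<phi>"
  shows "sat A v \<phi> \<longleftrightarrow> sat B w \<phi>"
proof -
  \<comment> \<open>With no centres the neighbourhood is empty, and its only tuple is
    \<open>[]\<close>. Positive arities keep it out of both relations, so any map is a local
    isomorphism.\<close>
  have "[] \<notin> rel A R" "[] \<notin> rel B R" if "R \<in> syms \<sigma>" for R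
    using assms(1) that structures_tupleD(2)[OF A, of "[]" R] structures_tupleD(2)[OF B, of "[]" R]
    by (auto simp: relational_signature_def)
  then have "similar \<sigma> (hanf_radius (qrank \<phi>)) {} A v B w"
    by (auto simp: similar_def local_iso_def)
  then show ?thesis
    using assms by (intro similar_sat_iff[of A \<sigma> B "qrank \<phi>" t \<phi> "{}"]) (auto simp: fo_sentence_def)
qed

section \<open>Size of neighbourhoods\<close>

lemma finite_tuples:
  assumes "relational_signature \<sigma>" and "A \<in> structures \<sigma>"
  shows "finite {(R, t). R \<in> syms \<sigma> \<and> t \<in> rel A R}"
proof -
  have "finite (SIGMA R:syms \<sigma>. {t. set t \<subseteq> univ A \<and> length t = arity \<sigma> R})"
    using assms by (intro finite_SigmaI finite_lists_length_eq) (auto simp: relational_signature_def structures_def)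
  then show ?thesis
    by (rule rev_finite_subset) (use structures_tupleD[OF assms(2)] in \<open>auto simp: subset_iff\<close>)
qed

lemma elem_degree_le:
  assumes "A \<in> bounded_structures \<sigma> d" and "a \<in> univ A"
  shows "elem_degree \<sigma> A a \<le> d"
  using assms by (auto simp: bounded_structures_def degree_def structures_def)

text \<open>The element itself, and at most \<open>d\<close> tuples with at most maximal arity many
  entries each. Inserting \<open>0\<close> covers the empty signature.\<close>

definition nbhd_bound :: "'r signature \<Rightarrow> nat \<Rightarrow> nat" where
  "nbhd_bound \<sigma> d = Suc (d * Max (insert 0 (arity \<sigma> ` syms \<sigma>)))"

lemma card_reach_le:
  assumes \<sigma>: "relational_signature \<sigma>" and A: "A \<in> bounded_structures \<sigma> d" and S: "S \<subseteq> univ A"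
  shows "card (reach \<sigma> A n S) \<le> card S * nbhd_bound \<sigma> d ^ n"
proof (induction n)
  case (Suc n)
  let ?m = "Max (insert 0 (arity \<sigma> ` syms \<sigma>))" and ?N = "reach \<sigma> A n S"
  have A': "A \<in> structures \<sigma>"
    using A by (simp add: bounded_structures_def)
  have N: "?N \<subseteq> univ A" "finite ?N"
    using A' reach_subset_univ[OF S] by (auto simp: structures_def intro: finite_subset)
  have one: "card ((gaifman \<sigma> A)\<^sup>= `` {a}) \<le> nbhd_bound \<sigma> d" if "a \<in> univ A" for a
  proof -
    define T where "T = {(R, t). R \<in> syms \<sigma> \<and> t \<in> rel A R \<and> a \<in> set t}"
    have T: "finite T" "card T \<le> d"
      using finite_tuples[OF \<sigma> A'] elem_degree_le[OF A that]
      by (auto simp: T_def elem_degree_def elim!: rev_finite_subset)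
    have "card (set t) \<le> ?m" if "(R, t) \<in> T" for R t
      using that \<sigma> structures_tupleD[OF A', of t R] card_length[of t]
      by (auto simp: T_def relational_signature_def Max_ge_iff intro!: order_trans[OF card_length])
    then have "(\<Sum>(R, t)\<in>T. card (set t)) \<le> card T * ?m"
      using sum_bounded_above[of T "\<lambda>(R, t). card (set t)" ?m] by auto
    moreover have "card (\<Union>(R, t)\<in>T. set t) \<le> (\<Sum>(R, t)\<in>T. card (set t))"
      using card_UN_le[OF T(1), of "\<lambda>(R, t). set t"] by (simp add: case_prod_unfold)
    moreover have "(gaifman \<sigma> A)\<^sup>= `` {a} \<subseteq> insert a (\<Union>(R, t)\<in>T. set t)"
      by (auto simp: gaifman_def T_def)
    moreover have "finite (\<Union>(R, t)\<in>T. set t)"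
      using T(1) by auto
    ultimately have "card ((gaifman \<sigma> A)\<^sup>= `` {a}) \<le> Suc (card T * ?m)"
      using card_mono[of "insert a (\<Union>(R, t)\<in>T. set t)" "(gaifman \<sigma> A)\<^sup>= `` {a}"]
        card_insert_if[of "\<Union>(R, t)\<in>T. set t" a] by (simp split: if_splits)
    also have "\<dots> \<le> nbhd_bound \<sigma> d"
      using T(2) by (simp add: nbhd_bound_def)
    finally show ?thesis .
  qed
  have "reach \<sigma> A (Suc n) S = (\<Union>a\<in>?N. (gaifman \<sigma> A)\<^sup>= `` {a})"
    by (auto simp: reach_Suc)
  then have "card (reach \<sigma> A (Suc n) S) \<le> (\<Sum>a\<in>?N. card ((gaifman \<sigma> A)\<^sup>= `` {a}))"
    using card_UN_le[OF N(2)] by simp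
  also have "\<dots> \<le> card ?N * nbhd_bound \<sigma> d"
    using one N(1) by (intro order_trans[OF sum_bounded_above[of ?N _ "nbhd_bound \<sigma> d"]]) auto
  also have "\<dots> \<le> card S * nbhd_bound \<sigma> d ^ Suc n"
    using Suc by (simp add: mult_ac)
  finally show ?case .
qed simp

section \<open>Types of elements\<close>

lemma univ_induced_nbhd:
  "a \<in> univ A \<Longrightarrow> univ (induced A (nbhd \<sigma> r A a)) = reach \<sigma> A r {a}"
  by (auto simp: induced_def nbhd_def simp flip: nbhd_eq_reach)

lemma induced_in_structures: "A \<in> structures \<sigma> \<Longrightarrow> induced A S \<in> structures \<sigma>"
  by (fastforce simp: structures_def induced_def)

lemma mem_balls_iff:
  "(B, b) \<in> balls \<sigma> r \<longleftrightarrow> B \<in> structures \<sigma> \<and> b \<in> univ B \<and> reach \<sigma> B r {b} = univ B"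
  by (simp add: balls_def nbhd_eq_reach eq_commute cong: conj_cong)

text \<open>Shortest walks from the centre stay inside the ball, so passing to the induced structure
  does not increase distances from \<open>a\<close>. This comes from \<open>local_iso_image\<close>
  for the identity, whose inclusion clause holds because the universe of \<open>?B\<close> is the
  neighbourhood.\<close>

lemma induced_nbhd_in_balls:
  assumes A: "A \<in> structures \<sigma>" and a: "a \<in> univ A"
  shows "(induced A (nbhd \<sigma> r A a), a) \<in> balls \<sigma> r"
proof -
  let ?B = "induced A (nbhd \<sigma> r A a)"
  have B: "?B \<in> structures \<sigma>" "univ ?B = reach \<sigma> A r {a}" "a \<in> univ ?B"
    using induced_in_structures[OF A] a subset_reach[of "{a}" \<sigma> A r]
    by (simp_all add: univ_induced_nbhd)
  have "reach \<sigma> ?B r {a} \<subseteq> reach \<sigma> A r {a}"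
    using B(2,3) reach_subset_univ[of "{a}" ?B \<sigma> r] by simp
  then have "local_iso \<sigma> A ?B r {a} id"
    using a B by (auto simp: local_iso_def induced_def nbhd_eq_reach in_lists_conv_set)
  then show ?thesis
    using local_iso_image[OF A B(1), of r "{a}" id] B by (simp add: mem_balls_iff)
qed

section \<open>Isomorphism of balls and its classes\<close>

lemma struct_iso_id: "struct_iso \<sigma> A A id"
  by (simp add: struct_iso_def)

lemma struct_iso_inv:
  assumes "struct_iso \<sigma> A B f"
  shows "struct_iso \<sigma> B A (inv_into (univ A) f)"
proof -
  let ?g = "inv_into (univ A) f"
  have f: "bij_betw f (univ A) (univ B)"
    using assms by (simp add: struct_iso_def)
  have "map f (map ?g t) = t" "map ?g t \<in> lists (univ A)" if "t \<in> lists (univ B)" for t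
    using that f by (auto simp: bij_betw_def f_inv_into_f inv_into_into intro!: map_idI)
  then have "t \<in> rel B R \<longleftrightarrow> map ?g t \<in> rel A R" if "R \<in> syms \<sigma>" "t \<in> lists (univ B)" for R t
    using that assms unfolding struct_iso_def by metis
  then show ?thesis
    using bij_betw_inv_into[OF f] by (simp add: struct_iso_def)
qed

lemma struct_iso_comp:
  assumes "struct_iso \<sigma> A B f" and "struct_iso \<sigma> B C g"
  shows "struct_iso \<sigma> A C (g \<circ> f)"
proof -
  have "map f t \<in> lists (univ B)" if "t \<in> lists (univ A)" for t
    using that bij_betw_apply[of f "univ A" "univ B"] assms(1) by (auto simp: struct_iso_def)
  then have "t \<in> rel A R \<longleftrightarrow> map (g \<circ> f) t \<in> rel C R" if "R \<in> syms \<sigma>" "t \<in> lists (univ A)" for R t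
    using that assms unfolding struct_iso_def by (metis map_map)
  then show ?thesis
    using assms bij_betw_trans by (auto simp: struct_iso_def)
qed

lemma equiv_ball_iso: "equiv (balls \<sigma> r) (ball_iso \<sigma> r)"
proof (rule equivI)
  show "ball_iso \<sigma> r \<subseteq> balls \<sigma> r \<times> balls \<sigma> r"
    by (auto simp: ball_iso_def)
  show "refl_on (balls \<sigma> r) (ball_iso \<sigma> r)"
    using struct_iso_id by (fastforce simp: refl_on_def ball_iso_def)
  show "sym (ball_iso \<sigma> r)"
  proof (rule symI)
    fix p q
    assume "(p, q) \<in> ball_iso \<sigma> r"
    then obtain B b C c f where *: "p = (B, b)" "q = (C, c)" "(B, b) \<in> balls \<sigma> r" "(C, c) \<in> balls \<sigma> r"
      "struct_iso \<sigma> B C f" "f b = c"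
      by (auto simp: ball_iso_def)
    then have "inv_into (univ B) f c = b"
      by (auto simp: struct_iso_def bij_betw_def mem_balls_iff)
    then show "(q, p) \<in> ball_iso \<sigma> r"
      using * struct_iso_inv[OF *(5)] by (auto simp: ball_iso_def)
  qed
  show "trans (ball_iso \<sigma> r)"
  proof (rule transI)
    fix p q s
    assume "(p, q) \<in> ball_iso \<sigma> r" "(q, s) \<in> ball_iso \<sigma> r"
    then obtain f g where "struct_iso \<sigma> (fst p) (fst q) f" "struct_iso \<sigma> (fst q) (fst s) g"
      "f (snd p) = snd q" "g (snd q) = snd s" "p \<in> balls \<sigma> r" "s \<in> balls \<sigma> r"
      by (auto simp: ball_iso_def)
    then show "(p, s) \<in> ball_iso \<sigma> r"
      using struct_iso_comp[of \<sigma> "fst p" "fst q" f "fst s" g]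
      by (auto simp: ball_iso_def case_prod_unfold intro!: exI[of _ "g \<circ> f"])
  qed
qed

lemma r_types_eq_class:
  assumes "\<tau> \<in> r_types \<sigma> r" and "has_r_type \<sigma> r A a \<tau>"
  shows "\<tau> = ball_iso \<sigma> r `` {(induced A (nbhd \<sigma> r A a), a)}"
proof -
  obtain p where p: "\<tau> = ball_iso \<sigma> r `` {p}"
    using assms(1) by (auto simp: r_types_def quotient_def)
  then show ?thesis
    using assms(2) equiv_class_eq[OF equiv_ball_iso, of p] by (auto simp: has_r_type_def)
qed

lemma r_types_unique:
  assumes "\<tau> \<in> r_types \<sigma> r" and "\<tau>' \<in> r_types \<sigma> r"
    and "has_r_type \<sigma> r A a \<tau>" and "has_r_type \<sigma> r A a \<tau>'"
  shows "\<tau> = \<tau>'"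
  using r_types_eq_class[OF assms(1,3)] r_types_eq_class[OF assms(2,4)] by simp

text \<open>Two members of one class are isomorphic balls; the isomorphism, read in the ambient
  structures, is a local isomorphism.\<close>

lemma has_r_type_same_type:
  assumes "\<tau> \<in> r_types \<sigma> r" and "a \<in> univ A" and "b \<in> univ B"
    and "has_r_type \<sigma> r A a \<tau>" and "has_r_type \<sigma> r B b \<tau>"
  shows "same_type \<sigma> r A a B b"
proof -
  let ?A = "induced A (nbhd \<sigma> r A a)" and ?B = "induced B (nbhd \<sigma> r B b)"
  have "((?A, a), (?B, b)) \<in> ball_iso \<sigma> r"
    using assms quotient_eq_iff[OF equiv_ball_iso, of \<tau> \<sigma> r \<tau>]
    unfolding r_types_def has_r_type_def by blast
  then obtain f where f: "struct_iso \<sigma> ?A ?B f" "f a = b"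
    by (auto simp: ball_iso_def)
  have N: "univ ?A = reach \<sigma> A r {a}" "univ ?B = reach \<sigma> B r {b}"
    using assms(2,3) by (simp_all add: univ_induced_nbhd)
  have "t \<in> rel A R \<longleftrightarrow> map f t \<in> rel B R" if "R \<in> syms \<sigma>" "t \<in> lists (reach \<sigma> A r {a})" for R t
  proof -
    have "t \<in> rel ?A R \<longleftrightarrow> map f t \<in> rel ?B R"
      using f(1) that N(1) unfolding struct_iso_def by simp
    moreover have "set t \<subseteq> nbhd \<sigma> r A a" "set (map f t) \<subseteq> nbhd \<sigma> r B b"
      using that(2) f(1) N nbhd_eq_reach[OF assms(2), of \<sigma> r] nbhd_eq_reach[OF assms(3), of \<sigma> r]
      by (auto simp: struct_iso_def bij_betw_def)
    ultimately show ?thesis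
      by (simp add: induced_def)
  qed
  then have "local_iso \<sigma> A B r {a} f"
    using f N assms(2,3) by (auto simp: local_iso_def struct_iso_def bij_betw_def)
  then show ?thesis
    using f(2) by (auto simp: same_type_def)
qed

lemma exists_bounded_r_type:
  assumes "A \<in> bounded_structures \<sigma> d" and "a \<in> univ A"
  shows "\<exists>\<tau>\<in>bounded_r_types \<sigma> d r. has_r_type \<sigma> r A a \<tau>"
proof -
  let ?p = "(induced A (nbhd \<sigma> r A a), a)"
  have p: "?p \<in> balls \<sigma> r"
    using assms induced_nbhd_in_balls by (auto simp: bounded_structures_def)
  then have "ball_iso \<sigma> r `` {?p} \<in> r_types \<sigma> r" "has_r_type \<sigma> r A a (ball_iso \<sigma> r `` {?p})"
    using equiv_class_self[OF equiv_ball_iso p]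
    by (auto simp: r_types_def has_r_type_def intro: quotientI)
  then show ?thesis
    using assms unfolding bounded_r_types_def by blast
qed

text \<open>That \<open>C\<close> is a ball around \<open>f b\<close> has to be shown: an
  isomorphism is a local isomorphism of every radius and therefore preserves
  \<open>reach\<close>.\<close>

lemma balls_struct_iso:
  assumes B: "(B, b) \<in> balls \<sigma> r" and C: "C \<in> structures \<sigma>" and f: "struct_iso \<sigma> B C f"
  shows "((B, b), (C, f b)) \<in> ball_iso \<sigma> r"
proof -
  have *: "B \<in> structures \<sigma>" "b \<in> univ B" "reach \<sigma> B r {b} = univ B"
    using B by (simp_all add: mem_balls_iff)
  have fb: "f b \<in> univ C" "f ` univ B = univ C"
    using f *(2) by (auto simp: struct_iso_def bij_betw_def)
  then have "local_iso \<sigma> B C r {b} f"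
    using f * reach_subset_univ[of "{f b}" C \<sigma> r] by (auto simp: local_iso_def struct_iso_def bij_betw_def)
  then have "(C, f b) \<in> balls \<sigma> r"
    using local_iso_image[OF *(1) C, of r "{b}" f] * fb C by (simp add: mem_balls_iff)
  then show ?thesis
    using B f by (auto simp: ball_iso_def)
qed

section \<open>Finiteness of the set of types\<close>

lemma structures_transport:
  assumes B: "B \<in> structures \<sigma>" and h: "inj_on h (univ B)"
  shows "\<exists>D\<in>structures \<sigma>. univ D = h ` univ B \<and> struct_iso \<sigma> B D h"
proof -
  define D where "D = \<lparr>univ = h ` univ B, rel = (\<lambda>R. map h ` rel B R)\<rparr>"
  have "D \<in> structures \<sigma>"
  proof -
    have "length t = arity \<sigma> R \<and> set t \<subseteq> univ D" if "t \<in> rel D R" for t R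
      using that structures_tupleD(2,3)[OF B] by (auto simp: D_def subset_iff)
    moreover have "rel D R = {}" if "R \<notin> syms \<sigma>" for R
      using that B by (simp add: D_def structures_def)
    moreover have "finite (univ D)"
      using B by (simp add: D_def structures_def)
    ultimately show ?thesis
      unfolding structures_def by blast
  qed
  moreover have "t \<in> rel B R \<longleftrightarrow> map h t \<in> rel D R" if "t \<in> lists (univ B)" for t R
  proof
    assume "map h t \<in> rel D R"
    then have "map h t \<in> map h ` rel B R"
      by (simp add: D_def)
    then obtain s where s: "map h t = map h s" "s \<in> rel B R"
      by (rule imageE)
    then have "inj_on h (set t \<union> set s)"
      using that structures_tupleD(3)[OF B s(2)] by (intro inj_on_subset[OF h]) blast
    then show "t \<in> rel B R"
      using s inj_on_map_eq_map[of h t s] by simp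
  qed (simp add: D_def)
  then have "struct_iso \<sigma> B D h"
    using h unfolding struct_iso_def by (simp add: D_def bij_betw_def)
  moreover have "univ D = h ` univ B"
    by (simp add: D_def)
  ultimately show ?thesis
    by blast
qed

text \<open>Symbols outside the signature are interpreted as empty, so a structure is determined by
  finitely many relations even if the type of symbols is infinite.\<close>

lemma finite_structures_on:
  assumes "relational_signature \<sigma>" and "finite U"
  shows "finite {A \<in> structures \<sigma>. univ A \<subseteq> U}"
proof -
  let ?T = "{t. set t \<subseteq> U \<and> length t \<le> Max (insert 0 (arity \<sigma> ` syms \<sigma>))}"
  let ?F = "{g. \<forall>R. (R \<in> syms \<sigma> \<longrightarrow> g R \<in> Pow ?T) \<and> (R \<notin> syms \<sigma> \<longrightarrow> g R = {})}"
  have "finite ?F"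
    using assms by (intro finite_set_of_finite_funs) (auto simp: relational_signature_def finite_lists_length_le)
  then have "finite ((\<lambda>(X, g). \<lparr>univ = X, rel = g\<rparr>) ` (Pow U \<times> ?F))"
    using assms(2) by simp
  moreover have "A \<in> (\<lambda>(X, g). \<lparr>univ = X, rel = g\<rparr>) ` (Pow U \<times> ?F)"
    if A: "A \<in> structures \<sigma>" "univ A \<subseteq> U" for A
  proof (rule image_eqI[of _ _ "(univ A, rel A)"])
    have "length t \<le> Max (insert 0 (arity \<sigma> ` syms \<sigma>))" if "t \<in> rel A R" for t R
      using structures_tupleD[OF A(1) that] assms(1) by (auto simp: relational_signature_def)
    then show "(univ A, rel A) \<in> Pow U \<times> ?F"
      using A(2) structures_tupleD(1,3)[OF A(1)] by (auto simp: subset_iff)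
  qed simp
  ultimately show ?thesis
    by (elim rev_finite_subset) blast
qed

text \<open>A class over an infinite element type is itself infinite. But each ball has at most
  \<open>nbhd_bound \<sigma> d ^ r\<close> elements, so it can be renamed into one fixed finite set
  \<open>U\<close>, on which only finitely many pointed structures exist.\<close>

lemma finite_bounded_r_types:
  fixes \<sigma> :: "'r signature"
  assumes \<sigma>: "relational_signature \<sigma>"
  shows "finite (bounded_r_types \<sigma> d r :: (('r, 'a::infinite) rel_structure \<times> 'a) set set)"
proof -
  obtain U :: "'a set" where U: "finite U" "card U = nbhd_bound \<sigma> d ^ r"
    using infinite_arbitrarily_large[OF infinite_UNIV] by blast
  let ?reps = "{A \<in> structures \<sigma>. univ A \<subseteq> U} \<times> U"
  have "\<tau> \<in> (\<lambda>p. ball_iso \<sigma> r `` {p}) ` ?reps" if \<tau>: "\<tau> \<in> bounded_r_types \<sigma> d r" for \<tau>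
  proof -
    obtain A a where A: "A \<in> bounded_structures \<sigma> d" "a \<in> univ A" "has_r_type \<sigma> r A a \<tau>" "\<tau> \<in> r_types \<sigma> r"
      using \<tau> by (auto simp: bounded_r_types_def)
    let ?B = "induced A (nbhd \<sigma> r A a)"
    have A': "A \<in> structures \<sigma>"
      using A(1) by (simp add: bounded_structures_def)
    have B: "?B \<in> structures \<sigma>" "univ ?B = reach \<sigma> A r {a}" "(?B, a) \<in> balls \<sigma> r"
      using induced_in_structures[OF A'] A(2) induced_nbhd_in_balls[OF A']
      by (simp_all add: univ_induced_nbhd)
    have "card (univ ?B) \<le> card U"
      using card_reach_le[OF \<sigma> A(1), of "{a}" r] A(2) B(2) U(2) by simp
    moreover have "finite (univ ?B)"
      using B(1) by (simp add: structures_def)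
    ultimately obtain h where h: "h ` univ ?B \<subseteq> U" "inj_on h (univ ?B)"
      using card_le_inj[OF _ U(1)] by blast
    then obtain D where D: "D \<in> structures \<sigma>" "univ D = h ` univ ?B" "struct_iso \<sigma> ?B D h"
      using structures_transport[OF B(1)] by blast
    have iso: "((?B, a), (D, h a)) \<in> ball_iso \<sigma> r"
      by (rule balls_struct_iso[OF B(3) D(1,3)])
    have "\<tau> = ball_iso \<sigma> r `` {(?B, a)}"
      by (rule r_types_eq_class[OF A(4,3)])
    also have "\<dots> = ball_iso \<sigma> r `` {(D, h a)}"
      by (rule equiv_class_eq[OF equiv_ball_iso iso])
    finally show ?thesis
      using D h(1) B(3) by (intro image_eqI) (auto simp: mem_balls_iff)
  qed
  then show ?thesis
    using finite_structures_on[OF \<sigma> U(1)] U(1) by (meson finite_SigmaI finite_imageI finite_subset subsetI)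
qed

section \<open>From histograms to profiles\<close>

lemma r_type_enum_bij:
  fixes \<sigma> :: "'r signature"
  assumes "relational_signature \<sigma>"
  shows "bij_betw (r_type_enum \<sigma> d r) {1..num_r_types TYPE(('r, 'a::infinite) rel_structure) \<sigma> d r}
    (bounded_r_types \<sigma> d r :: (('r, 'a) rel_structure \<times> 'a) set set)"
proof -
  have "\<exists>e. bij_betw e {1..num_r_types TYPE(('r, 'a) rel_structure) \<sigma> d r}
      (bounded_r_types \<sigma> d r :: (('r, 'a) rel_structure \<times> 'a) set set)"
    unfolding num_r_types_def
    using finite_bounded_r_types[OF assms] by (intro finite_same_card_bij) auto
  then show ?thesis
    unfolding r_type_enum_def by (rule someI_ex)
qed

lemma r_type_enum:
  fixes \<sigma> :: "'r signature"
  assumes "relational_signature \<sigma>" and "i \<in> {1..num_r_types TYPE(('r, 'a::infinite) rel_structure) \<sigma> d r}"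
  shows "r_type_enum \<sigma> d r i \<in> (r_types \<sigma> r :: (('r, 'a) rel_structure \<times> 'a) set set)"
  using bij_betw_apply[OF r_type_enum_bij[OF assms(1)] assms(2)] by (simp add: bounded_r_types_def)

text \<open>\<open>F\<close> splits into fibres by type. Each fibre has at most \<open>t\<close>
  elements and at most as many as the histogram entry of \<open>A\<close>, so it injects into the
  elements of that type in \<open>B\<close>. Images of different fibres are disjoint because an
  element has only one type.\<close>

lemma type_counts_le_histogram:
  fixes \<sigma> :: "'r signature" and A B :: "('r, 'a::infinite) rel_structure"
  assumes \<sigma>: "relational_signature \<sigma>"
    and A: "A \<in> bounded_structures \<sigma> d" and B: "B \<in> bounded_structures \<sigma> d"
    and le: "\<And>i. i \<in> {1..num_r_types TYPE(('r, 'a) rel_structure) \<sigma> d r}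
      \<Longrightarrow> min t (histogram \<sigma> d r A i) \<le> histogram \<sigma> d r B i"
  shows "type_counts_le \<sigma> r t A B"
  unfolding type_counts_le_def
proof (intro allI impI)
  fix F assume F: "F \<subseteq> univ A" "card F \<le> t"
  let ?I = "{1..num_r_types TYPE(('r, 'a) rel_structure) \<sigma> d r}"
  let ?e = "r_type_enum \<sigma> d r :: nat \<Rightarrow> (('r, 'a) rel_structure \<times> 'a) set"
  have fin: "finite (univ A)" "finite (univ B)"
    using A B by (simp_all add: bounded_structures_def structures_def)
  have bij: "bij_betw ?e ?I (bounded_r_types \<sigma> d r)"
    by (rule r_type_enum_bij[OF \<sigma>])
  have "\<exists>i\<in>?I. has_r_type \<sigma> r A a (?e i)" if a: "a \<in> F" for a
  proof -
    obtain \<tau> where "\<tau> \<in> bounded_r_types \<sigma> d r" "has_r_type \<sigma> r A a \<tau>"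
      using exists_bounded_r_type[OF A, of a r] F(1) a by blast
    moreover obtain i where "i \<in> ?I" "\<tau> = ?e i"
      using \<open>\<tau> \<in> bounded_r_types \<sigma> d r\<close> unfolding bij_betw_imp_surj_on[OF bij, symmetric] by (rule imageE)
    ultimately show ?thesis
      by blast
  qed
  then obtain idx where idx: "\<And>a. a \<in> F \<Longrightarrow> idx a \<in> ?I \<and> has_r_type \<sigma> r A a (?e (idx a))"
    by metis
  have "\<forall>i\<in>?I. \<exists>g. g ` {a \<in> F. idx a = i} \<subseteq> {b \<in> univ B. has_r_type \<sigma> r B b (?e i)} \<and> inj_on g {a \<in> F. idx a = i}"
  proof (intro ballI card_le_inj)
    fix i assume i: "i \<in> ?I"
    have "card {a \<in> F. idx a = i} \<le> card F"
      using F(1) fin(1) finite_subset by (intro card_mono) auto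
    moreover have "card {a \<in> F. idx a = i} \<le> histogram \<sigma> d r A i"
      unfolding histogram_def using F(1) fin(1) idx by (intro card_mono) auto
    ultimately show "card {a \<in> F. idx a = i} \<le> card {b \<in> univ B. has_r_type \<sigma> r B b (?e i)}"
      using le[OF i] F(2) by (simp add: histogram_def)
  qed (use F(1) fin in \<open>auto intro: finite_subset\<close>)
  from bchoice[OF this] obtain g where g: "\<And>i. i \<in> ?I \<Longrightarrow> g i ` {a \<in> F. idx a = i} \<subseteq> {b \<in> univ B. has_r_type \<sigma> r B b (?e i)}"
    "\<And>i. i \<in> ?I \<Longrightarrow> inj_on (g i) {a \<in> F. idx a = i}"
    by blast
  define h where "h a = g (idx a) a" for a
  have h: "h a \<in> univ B" "has_r_type \<sigma> r B (h a) (?e (idx a))" if "a \<in> F" for a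
    using g(1)[of "idx a"] idx[OF that] that unfolding h_def by blast+
  have "inj_on h F"
  proof (rule inj_onI)
    fix a b assume ab: "a \<in> F" "b \<in> F" "h a = h b"
    have "?e (idx a) = ?e (idx b)"
      using h(2)[OF ab(1)] h(2)[OF ab(2)] ab(3) idx[OF ab(1)] idx[OF ab(2)] r_type_enum[OF \<sigma>]
      by (intro r_types_unique[of _ \<sigma> r _ B "h a"]) auto
    then have "idx a = idx b"
      using inj_onD[OF bij_betw_imp_inj_on[OF bij]] idx[OF ab(1)] idx[OF ab(2)] by blast
    then show "a = b"
      using inj_onD[OF g(2)[of "idx a"], of a b] idx[OF ab(1)] ab by (simp add: h_def)
  qed
  moreover have "same_type \<sigma> r A a B (h a)" if "a \<in> F" for a
    using that F(1) h[OF that] idx[OF that] r_type_enum[OF \<sigma>]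
    by (intro has_r_type_same_type[of "?e (idx a)"]) auto
  ultimately show "\<exists>g. inj_on g F \<and> (\<forall>a\<in>F. same_type \<sigma> r A a B (g a))"
    by blast
qed

lemma fo_definable_imp_profiles:
  fixes \<sigma> :: "'r signature" and P :: "('r, 'a::infinite) rel_structure set"
  assumes \<sigma>: "relational_signature \<sigma>" and P: "fo_definable \<sigma> d P"
  shows "\<exists>(k::nat) (r :: nat \<Rightarrow> nat) (\<rho> :: nat \<Rightarrow> nat \<Rightarrow> nat set).
       (\<forall>i\<in>{1..k}. nbhd_profile TYPE(('r, 'a) rel_structure) \<sigma> d (r i) (\<rho> i)) \<and>
       P = (\<Union>i\<in>{1..k}. profile_property \<sigma> d (r i) (\<rho> i))"
proof -
  obtain \<phi> where \<phi>: "fo_sentence \<sigma> \<phi>" "P = {A \<in> bounded_structures \<sigma> d. A \<Turnstile> \<phi>}"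
    using P by (auto simp: fo_definable_def)
  define r where "r = hanf_radius (qrank \<phi>)"
  \<comment> \<open>The bound of \<open>card_reach_le\<close> for \<open>qrank \<phi>\<close>
    centres; \<open>Suc\<close> leaves room for the extra element counted in
    \<open>exists_far_same_type\<close>.\<close>
  define t where "t = Suc (qrank \<phi> * nbhd_bound \<sigma> d ^ r)"
  let ?I = "{1..num_r_types TYPE(('r, 'a) rel_structure) \<sigma> d r}"
  \<comment> \<open>The default \<open>0\<close> off the index range leaves only finitely many
    functions \<open>thr A\<close>.\<close>
  define thr :: "('r, 'a) rel_structure \<Rightarrow> nat \<Rightarrow> nat"
    where "thr A i = (if i \<in> ?I then min t (histogram \<sigma> d r A i) else 0)" for A i
  \<comment> \<open>Below \<open>t\<close> a truncated count is exact; the value \<open>t\<close>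
    means at least \<open>t\<close>, hence the unbounded interval.\<close>
  define ivl where "ivl c = (\<lambda>i::nat. if c i < t then {c i..c i} else {c i::nat..})" for c
  have small: "card (reach \<sigma> A r S) < t"
    if "A \<in> bounded_structures \<sigma> d" "S \<subseteq> univ A" "card S \<le> qrank \<phi>" for A :: "('r, 'a) rel_structure" and S
  proof -
    have "card (reach \<sigma> A r S) \<le> card S * nbhd_bound \<sigma> d ^ r"
      by (rule card_reach_le[OF \<sigma> that(1,2)])
    also have "\<dots> \<le> qrank \<phi> * nbhd_bound \<sigma> d ^ r"
      using that(3) by (rule mult_right_mono) simp
    finally show ?thesis
      by (simp add: t_def)
  qed
  have same: "B \<in> P" if A: "A \<in> P" and B: "B \<in> profile_property \<sigma> d r (ivl (thr A))" for A B
  proof -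
    have A': "A \<in> bounded_structures \<sigma> d" and B': "B \<in> bounded_structures \<sigma> d"
      using A B \<phi>(2) by (auto simp: profile_property_def)
    have le: "min t (histogram \<sigma> d r A i) \<le> histogram \<sigma> d r B i"
      "min t (histogram \<sigma> d r B i) \<le> histogram \<sigma> d r A i" if "i \<in> ?I" for i
    proof -
      have "histogram \<sigma> d r B i \<in> ivl (thr A) i"
        using B that by (simp add: profile_property_def)
      then show "min t (histogram \<sigma> d r A i) \<le> histogram \<sigma> d r B i"
        "min t (histogram \<sigma> d r B i) \<le> histogram \<sigma> d r A i"
        using that by (auto simp: ivl_def thr_def split: if_splits)
    qed
    have "type_counts_le \<sigma> r t A B" "type_counts_le \<sigma> r t B A"
      using le by (auto intro: type_counts_le_histogram[OF \<sigma> A' B'] type_counts_le_histogram[OF \<sigma> B' A'])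
    then have "sat A v \<phi> \<longleftrightarrow> sat B v \<phi>" for v
      using A' B' small unfolding r_def
      by (intro hanf[OF \<sigma> _ _ _ _ _ _ \<phi>(1)]) (auto simp: bounded_structures_def)
    then show ?thesis
      using A B' \<phi>(2) by (simp add: models_def)
  qed
  have self: "A \<in> profile_property \<sigma> d r (ivl (thr A))" if "A \<in> P" for A
    using that \<phi>(2) by (auto simp: profile_property_def ivl_def thr_def)
  have P_eq: "P = (\<Union>c\<in>thr ` P. profile_property \<sigma> d r (ivl c))"
    using same self by blast
  have "finite (thr ` P)"
  proof (rule finite_subset)
    show "thr ` P \<subseteq> {f. \<forall>i. (i \<in> ?I \<longrightarrow> f i \<in> {..t}) \<and> (i \<notin> ?I \<longrightarrow> f i = 0)}"
      by (auto simp: thr_def)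
  qed (intro finite_set_of_finite_funs; simp)
  then obtain e :: "nat \<Rightarrow> nat \<Rightarrow> nat" where e: "bij_betw e {1..card (thr ` P)} (thr ` P)"
    using finite_same_card_bij[of "{1..card (thr ` P)}" "thr ` P"] by auto
  have "P = (\<Union>j\<in>{1..card (thr ` P)}. profile_property \<sigma> d r (ivl (e j)))"
    by (subst P_eq, subst bij_betw_imp_surj_on[OF e, symmetric]) (simp only: image_image)
  moreover have "nbhd_profile TYPE(('r, 'a) rel_structure) \<sigma> d r (ivl c)" for c
  proof -
    have "{m..m} \<in> profile_intervals" "{m..} \<in> profile_intervals" for m
      unfolding profile_intervals_def by blast+
    then show ?thesis
      unfolding nbhd_profile_def ivl_def by (simp del: atLeastAtMost_singleton)
  qed
  ultimately show ?thesis
    by (intro exI[of _ "card (thr ` P)"] exI[of _ "\<lambda>_. r"] exI[of _ "\<lambda>j. ivl (e j)"]) simp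
qed

section \<open>Defining neighbourhood profiles\<close>

text \<open>Tracks definability semantically: the closure lemmas act as connectives and quantifiers,
  and large formulas never have to be written out.\<close>

definition expressible ::
  "'r signature \<Rightarrow> nat set \<Rightarrow> (('r, 'a) rel_structure \<Rightarrow> (nat \<Rightarrow> 'a) \<Rightarrow> bool) \<Rightarrow> bool" where
  "expressible \<sigma> V Q \<longleftrightarrow> (\<exists>\<phi>. fo_over \<sigma> \<phi> \<and> free_vars \<phi> \<subseteq> V
     \<and> (\<forall>A\<in>structures \<sigma>. \<forall>v. sat A v \<phi> \<longleftrightarrow> Q A v))"

lemma expressible_cong:
  assumes "expressible \<sigma> V Q" and "\<And>A v. A \<in> structures \<sigma> \<Longrightarrow> Q A v \<longleftrightarrow> Q' A v"
  shows "expressible \<sigma> V Q'"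
  using assms by (auto simp: expressible_def)

lemma expressible_mono: "expressible \<sigma> V Q \<Longrightarrow> V \<subseteq> V' \<Longrightarrow> expressible \<sigma> V' Q"
  unfolding expressible_def by (meson subset_trans)

lemma expressible_eq: "x \<in> V \<Longrightarrow> y \<in> V \<Longrightarrow> expressible \<sigma> V (\<lambda>A v. v x = v y)"
  unfolding expressible_def by (intro exI[of _ "Eq x y"]) auto

lemma expressible_atom:
  assumes "R \<in> syms \<sigma>" and "length xs = arity \<sigma> R" and "set xs \<subseteq> V"
  shows "expressible \<sigma> V (\<lambda>A v. map v xs \<in> rel A R)"
  unfolding expressible_def using assms by (intro exI[of _ "Atom R xs"]) auto

lemma expressible_not:
  assumes "expressible \<sigma> V Q"
  shows "expressible \<sigma> V (\<lambda>A v. \<not> Q A v)"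
proof -
  obtain \<phi> where "fo_over \<sigma> \<phi>" "free_vars \<phi> \<subseteq> V" "\<forall>A\<in>structures \<sigma>. \<forall>v. sat A v \<phi> \<longleftrightarrow> Q A v"
    using assms by (auto simp: expressible_def)
  then show ?thesis
    unfolding expressible_def by (intro exI[of _ "Neg \<phi>"]) auto
qed

lemma expressible_conj:
  assumes "expressible \<sigma> V Q" and "expressible \<sigma> V Q'"
  shows "expressible \<sigma> V (\<lambda>A v. Q A v \<and> Q' A v)"
proof -
  obtain \<phi> where "fo_over \<sigma> \<phi>" "free_vars \<phi> \<subseteq> V" "\<forall>A\<in>structures \<sigma>. \<forall>v. sat A v \<phi> \<longleftrightarrow> Q A v"
    using assms(1) by (auto simp: expressible_def)
  moreover obtain \<psi> where "fo_over \<sigma> \<psi>" "free_vars \<psi> \<subseteq> V" "\<forall>A\<in>structures \<sigma>. \<forall>v. sat A v \<psi> \<longleftrightarrow> Q' A v"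
    using assms(2) by (auto simp: expressible_def)
  ultimately show ?thesis
    unfolding expressible_def by (intro exI[of _ "Conj \<phi> \<psi>"]) auto
qed

lemma expressible_Bex:
  assumes "expressible \<sigma> (insert x V) Q"
  shows "expressible \<sigma> V (\<lambda>A v. \<exists>a\<in>univ A. Q A (v(x := a)))"
proof -
  obtain \<phi> where "fo_over \<sigma> \<phi>" "free_vars \<phi> \<subseteq> insert x V" "\<forall>A\<in>structures \<sigma>. \<forall>v. sat A v \<phi> \<longleftrightarrow> Q A v"
    using assms by (auto simp: expressible_def)
  then show ?thesis
    unfolding expressible_def by (intro exI[of _ "Exists x \<phi>"]) auto
qed

lemma expressible_disj:
  assumes "expressible \<sigma> V Q" and "expressible \<sigma> V Q'"
  shows "expressible \<sigma> V (\<lambda>A v. Q A v \<or> Q' A v)"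
  using expressible_not[OF expressible_conj[OF expressible_not[OF assms(1)] expressible_not[OF assms(2)]]]
  by simp

lemma expressible_iff:
  assumes "expressible \<sigma> V Q" and "expressible \<sigma> V Q'"
  shows "expressible \<sigma> V (\<lambda>A v. Q A v \<longleftrightarrow> Q' A v)"
  using expressible_disj[OF expressible_conj[OF assms] expressible_conj[OF assms[THEN expressible_not]]]
  by (rule expressible_cong) blast

lemma expressible_Ball:
  assumes "expressible \<sigma> (insert x V) Q"
  shows "expressible \<sigma> V (\<lambda>A v. \<forall>a\<in>univ A. Q A (v(x := a)))"
  using expressible_not[OF expressible_Bex[OF expressible_not[OF assms]]] by simp

text \<open>The syntax has no truth constants. An element different from itself exists in no
  structure, not even the empty one, and the bound variable keeps \<open>V\<close>
  arbitrary.\<close>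

lemma expressible_const: "expressible \<sigma> V (\<lambda>A v. b)"
proof -
  have "expressible \<sigma> V (\<lambda>A v. \<exists>a\<in>univ A. \<not> (v(0 := a)) 0 = (v(0 := a)) 0)"
    by (intro expressible_Bex expressible_not expressible_eq) auto
  then have "expressible \<sigma> V (\<lambda>A v. False)"
    by simp
  then show ?thesis
    using expressible_not[of \<sigma> V "\<lambda>A v. False"] by (cases b) auto
qed

lemma expressible_finite_Ball:
  assumes "finite I" and "\<And>i. i \<in> I \<Longrightarrow> expressible \<sigma> V (Q i)"
  shows "expressible \<sigma> V (\<lambda>A v. \<forall>i\<in>I. Q i A v)"
  using assms by (induction I rule: finite_induct) (auto intro: expressible_const expressible_conj)

lemma expressible_finite_Bex:
  assumes "finite I" and "\<And>i. i \<in> I \<Longrightarrow> expressible \<sigma> V (Q i)"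
  shows "expressible \<sigma> V (\<lambda>A v. \<exists>i\<in>I. Q i A v)"
  using assms by (induction I rule: finite_induct) (auto intro: expressible_const expressible_disj)

text \<open>A block of existential quantifiers, with its witnesses collected in a single function so
  that they can be treated as an enumeration.\<close>

lemma expressible_Ex_many:
  assumes "finite S" and "expressible \<sigma> (S \<union> V) Q"
  shows "expressible \<sigma> V (\<lambda>A v. \<exists>f. f ` S \<subseteq> univ A \<and> Q A (override_on v f S))"
  using assms
proof (induction S arbitrary: V rule: finite_induct)
  case empty
  then show ?case by (simp add: override_on_emptyset)
next
  case (insert x S)
  have "expressible \<sigma> (insert x V) (\<lambda>A v. \<exists>f. f ` S \<subseteq> univ A \<and> Q A (override_on v f S))"
    using insert.prems by (intro insert.IH) simp
  then have "expressible \<sigma> V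
      (\<lambda>A v. \<exists>a\<in>univ A. \<exists>f. f ` S \<subseteq> univ A \<and> Q A (override_on (v(x := a)) f S))"
    by (rule expressible_Bex)
  then show ?case
  proof (rule expressible_cong)
    fix A :: "('a, 'b) rel_structure" and v :: "nat \<Rightarrow> 'b"
    have eq: "override_on (v(x := a)) f S = override_on v (f(x := a)) (insert x S)" for a :: 'b and f
      using insert.hyps(2) by (auto simp: override_on_def fun_eq_iff)
    show "(\<exists>a\<in>univ A. \<exists>f. f ` S \<subseteq> univ A \<and> Q A (override_on (v(x := a)) f S)) \<longleftrightarrow>
        (\<exists>f. f ` insert x S \<subseteq> univ A \<and> Q A (override_on v f (insert x S)))" (is "?l \<longleftrightarrow> ?r")
    proof
      assume ?l
      then obtain a f where "a \<in> univ A" "f ` S \<subseteq> univ A" "Q A (override_on v (f(x := a)) (insert x S))"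
        unfolding eq by blast
      then show ?r
        using insert.hyps(2) by (intro exI[of _ "f(x := a)"]) auto
    next
      assume ?r
      then obtain f where f: "f ` insert x S \<subseteq> univ A" "Q A (override_on v f (insert x S))"
        by blast
      then show ?l
        unfolding eq by (intro bexI[of _ "f x"] exI[of _ f]) auto
    qed
  qed
qed

section \<open>Formulas for distances, types and counts\<close>

lemma expressible_gaifman:
  assumes \<sigma>: "relational_signature \<sigma>"
  shows "expressible \<sigma> {x, z} (\<lambda>A v. (v x, v z) \<in> gaifman \<sigma> A)"
proof -
  \<comment> \<open>The block of variables for the guessed tuple starts above \<open>x\<close> and
    \<open>z\<close>, so overriding it leaves their values alone.\<close>
  define N where "N = Suc (x + z)"
  let ?S = "\<lambda>R. {N..<N + arity \<sigma> R}"
  let ?Q = "\<lambda>R A v. map v [N..<N + arity \<sigma> R] \<in> rel A R \<and> (\<exists>i\<in>?S R. v x = v i) \<and> (\<exists>i\<in>?S R. v z = v i)"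
  have "expressible \<sigma> {x, z} (\<lambda>A v. \<not> v x = v z \<and>
      (\<exists>R\<in>syms \<sigma>. \<exists>f. f ` ?S R \<subseteq> univ A \<and> ?Q R A (override_on v f (?S R))))"
    using \<sigma>
    by (intro expressible_conj expressible_not expressible_finite_Bex expressible_Ex_many
        expressible_eq expressible_atom) (auto simp: relational_signature_def)
  then show ?thesis
  proof (rule expressible_cong)
    fix A :: "('a, 'b) rel_structure" and v
    assume A: "A \<in> structures \<sigma>"
    have "(\<exists>f. f ` ?S R \<subseteq> univ A \<and> ?Q R A (override_on v f (?S R))) \<longleftrightarrow>
        (\<exists>t\<in>rel A R. v x \<in> set t \<and> v z \<in> set t)" (is "?l \<longleftrightarrow> ?r") for R
    proof
      assume ?l
      then obtain f where f: "?Q R A (override_on v f (?S R))"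
        by blast
      have "override_on v f (?S R) x = v x" "override_on v f (?S R) z = v z"
        by (simp_all add: override_on_def N_def)
      then have "v x \<in> set (map (override_on v f (?S R)) [N..<N + arity \<sigma> R])"
        "v z \<in> set (map (override_on v f (?S R)) [N..<N + arity \<sigma> R])"
        using f by auto
      then show ?r
        using f by blast
    next
      assume ?r
      then obtain t where t: "t \<in> rel A R" "v x \<in> set t" "v z \<in> set t"
        by blast
      define f where "f i = t ! (i - N)" for i
      have len: "length t = arity \<sigma> R" "set t \<subseteq> univ A"
        using structures_tupleD[OF A t(1)] by auto
      have mapf: "map (override_on v f (?S R)) [N..<N + arity \<sigma> R] = t"
        using len(1) by (intro nth_equalityI) (auto simp: f_def override_on_def)
      then have img: "override_on v f (?S R) ` ?S R = set t"
        by (metis set_map set_upt)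
      have "f ` ?S R = override_on v f (?S R) ` ?S R"
        by (auto simp: override_on_def)
      then have "f ` ?S R \<subseteq> univ A"
        using img len(2) by simp
      moreover have "override_on v f (?S R) x = v x" "override_on v f (?S R) z = v z"
        by (simp_all add: override_on_def N_def)
      moreover have "\<exists>i\<in>?S R. v x = override_on v f (?S R) i" "\<exists>i\<in>?S R. v z = override_on v f (?S R) i"
        using t(2,3) unfolding img[symmetric] by auto
      ultimately show ?l
        using mapf t(1) by (intro exI[of _ f]) simp
    qed
    then show "(\<not> v x = v z \<and> (\<exists>R\<in>syms \<sigma>. \<exists>f. f ` ?S R \<subseteq> univ A \<and> ?Q R A (override_on v f (?S R))))
        \<longleftrightarrow> (v x, v z) \<in> gaifman \<sigma> A"
      using structures_tupleD(3)[OF A] unfolding gaifman_def by (simp add: subset_iff) blast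
  qed
qed

text \<open>The last step idles or follows an edge. Edges join elements of the universe, so
  quantifying the last intermediate point over it loses nothing, even when \<open>v x\<close> lies
  outside.\<close>

lemma expressible_reach:
  assumes \<sigma>: "relational_signature \<sigma>"
  shows "expressible \<sigma> {x, z} (\<lambda>(A :: ('r, 'a) rel_structure) v. (v x, v z) \<in> (gaifman \<sigma> A)\<^sup>= ^^ n)"
proof (induction n arbitrary: z)
  case 0
  then show ?case by (simp add: expressible_eq)
next
  case (Suc n)
  define y where "y = Suc (x + z)"
  have "expressible \<sigma> {x, z} (\<lambda>(A :: ('r, 'a) rel_structure) v. (v x, v z) \<in> (gaifman \<sigma> A)\<^sup>= ^^ n \<or>
      (\<exists>a\<in>univ A. ((v(y := a)) x, (v(y := a)) y) \<in> (gaifman \<sigma> A)\<^sup>= ^^ n \<and>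
        ((v(y := a)) y, (v(y := a)) z) \<in> gaifman \<sigma> A))"
    by (intro expressible_disj expressible_Bex expressible_conj expressible_mono[OF Suc.IH[of y]] Suc.IH
        expressible_mono[OF expressible_gaifman[OF \<sigma>]]) auto
  then show ?case
  proof (rule expressible_cong)
    fix A :: "('r, 'a) rel_structure" and v
    have "y \<noteq> x" "y \<noteq> z"
      by (simp_all add: y_def)
    moreover have "(v x, v z) \<in> (gaifman \<sigma> A)\<^sup>= ^^ Suc n \<longleftrightarrow> (v x, v z) \<in> (gaifman \<sigma> A)\<^sup>= ^^ n \<or>
        (\<exists>a. (v x, a) \<in> (gaifman \<sigma> A)\<^sup>= ^^ n \<and> (a, v z) \<in> gaifman \<sigma> A)"
      by auto
    moreover have "a \<in> univ A" if "(a, b) \<in> gaifman \<sigma> A" for a b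
      using that by (simp add: gaifman_def)
    ultimately show "((v x, v z) \<in> (gaifman \<sigma> A)\<^sup>= ^^ n \<or>
      (\<exists>a\<in>univ A. ((v(y := a)) x, (v(y := a)) y) \<in> (gaifman \<sigma> A)\<^sup>= ^^ n \<and>
        ((v(y := a)) y, (v(y := a)) z) \<in> gaifman \<sigma> A)) \<longleftrightarrow> (v x, v z) \<in> (gaifman \<sigma> A)\<^sup>= ^^ Suc n"
      by (metis fun_upd_other fun_upd_same)
  qed
qed

lemma has_r_type_iff_struct_iso:
  assumes A: "A \<in> structures \<sigma>" and a: "a \<in> univ A"
    and C: "(C, c) \<in> balls \<sigma> r"
  shows "has_r_type \<sigma> r A a (ball_iso \<sigma> r `` {(C, c)}) \<longleftrightarrow>
    (\<exists>g. struct_iso \<sigma> C (induced A (nbhd \<sigma> r A a)) g \<and> g c = a)"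
  using C induced_nbhd_in_balls[OF A a, of r] by (auto simp: has_r_type_def ball_iso_def)

text \<open>
  A type is described by listing the elements of a ball: \<open>u\<close> enumerates the neighbourhood of
  \<open>a\<close> as \<open>h\<close> enumerates the ball \<open>C\<close>.
\<close>

lemma struct_iso_induced_iff_enumeration:
  assumes A: "A \<in> structures \<sigma>" and a: "a \<in> univ A" and C: "C \<in> structures \<sigma>"
    and h: "bij_betw h S (univ C)" and i: "i \<in> S"
  shows "(\<exists>g. struct_iso \<sigma> C (induced A (nbhd \<sigma> r A a)) g \<and> g (h i) = a) \<longleftrightarrow>
    (\<exists>u. u ` S \<subseteq> univ A \<and> inj_on u S \<and> a = u i
      \<and> (\<forall>z\<in>univ A. (a, z) \<in> (gaifman \<sigma> A)\<^sup>= ^^ r \<longleftrightarrow> (\<exists>j\<in>S. z = u j))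
      \<and> (\<forall>R\<in>syms \<sigma>. \<forall>s\<in>{s. set s \<subseteq> S \<and> length s = arity \<sigma> R}. map u s \<in> rel A R \<longleftrightarrow> map h s \<in> rel C R))"
    (is "?l \<longleftrightarrow> (\<exists>u. ?r u)")
proof
  let ?N = "nbhd \<sigma> r A a"
  have N: "univ (induced A ?N) = ?N" "rel (induced A ?N) R = {t \<in> rel A R. set t \<subseteq> ?N}" for R
    by (auto simp: induced_def nbhd_def)
  assume ?l
  then obtain g where g: "struct_iso \<sigma> C (induced A ?N) g" "g (h i) = a"
    by blast
  have bij: "bij_betw (g \<circ> h) S ?N"
    using g(1) h N by (auto simp: struct_iso_def intro: bij_betw_trans)
  have "map (g \<circ> h) s \<in> rel A R \<longleftrightarrow> map h s \<in> rel C R" if "R \<in> syms \<sigma>" "set s \<subseteq> S" for s R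
  proof -
    have "map h s \<in> lists (univ C)"
      using that(2) bij_betw_apply[OF h] by (auto simp: subset_iff)
    then have "map h s \<in> rel C R \<longleftrightarrow> map g (map h s) \<in> rel (induced A ?N) R"
      using g(1) that(1) unfolding struct_iso_def by blast
    moreover have "set (map (g \<circ> h) s) \<subseteq> ?N"
      using bij that(2) by (auto simp: bij_betw_def)
    ultimately show ?thesis
      by (simp add: N)
  qed
  moreover have "(a, z) \<in> (gaifman \<sigma> A)\<^sup>= ^^ r \<longleftrightarrow> (\<exists>j\<in>S. z = (g \<circ> h) j)" if "z \<in> univ A" for z
  proof -
    have "z \<in> ?N \<longleftrightarrow> (\<exists>j\<in>S. z = (g \<circ> h) j)"
      unfolding bij_betw_imp_surj_on[OF bij, symmetric] by (rule image_iff)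
    then show ?thesis
      using that by (simp add: mem_nbhd_iff)
  qed
  moreover have "inj_on (g \<circ> h) S" "(g \<circ> h) ` S \<subseteq> univ A" "a = (g \<circ> h) i"
    using bij g(2) by (auto simp: bij_betw_def nbhd_def)
  ultimately have "?r (g \<circ> h)"
    by simp
  then show "\<exists>u. ?r u"
    by (rule exI[of _ "g \<circ> h"])
next
  let ?N = "nbhd \<sigma> r A a"
  have N: "univ (induced A ?N) = ?N" "rel (induced A ?N) R = {t \<in> rel A R. set t \<subseteq> ?N}" for R
    by (auto simp: induced_def nbhd_def)
  assume "\<exists>u. ?r u"
  then obtain u where u: "?r u" ..
  let ?h = "inv_into S h"
  have h': "bij_betw ?h (univ C) S"
    by (rule bij_betw_inv_into[OF h])
  have rel_u: "map u s \<in> rel A R \<longleftrightarrow> map h s \<in> rel C R"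
    if "R \<in> syms \<sigma>" "set s \<subseteq> S" "length s = arity \<sigma> R" for R s
    using u that by blast
  have "z \<in> u ` S \<longleftrightarrow> z \<in> ?N" for z
  proof (cases "z \<in> univ A")
    case True
    then show ?thesis
      using u unfolding mem_nbhd_iff image_iff by blast
  next
    case False
    then have "z \<notin> u ` S"
      using u by blast
    then show ?thesis
      using False by (simp add: mem_nbhd_iff)
  qed
  then have "u ` S = ?N"
    by blast
  then have bij: "bij_betw (u \<circ> ?h) (univ C) ?N"
    using u by (intro bij_betw_trans[OF h']) (simp add: bij_betw_def)
  have "t \<in> rel C R \<longleftrightarrow> map (u \<circ> ?h) t \<in> rel (induced A ?N) R"
    if "R \<in> syms \<sigma>" "t \<in> lists (univ C)" for R t
  \<comment> \<open>The enumeration condition speaks only of lists of the right length; others lie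
    in neither relation.\<close>
  proof (cases "length t = arity \<sigma> R")
    case True
    have "set (map ?h t) \<subseteq> S" "map h (map ?h t) = t" "set (map (u \<circ> ?h) t) \<subseteq> ?N"
      using that(2) h h' bij by (auto simp: bij_betw_def f_inv_into_f intro!: map_idI)
    then show ?thesis
      using rel_u[OF that(1), of "map ?h t"] True by (simp add: N(2))
  next
    case False
    then show ?thesis
      using structures_tupleD(2)[OF C, of t R] structures_tupleD(2)[OF A, of "map (u \<circ> ?h) t" R]
      by (auto simp: N)
  qed
  moreover have "(u \<circ> ?h) (h i) = a"
    using u h i by (simp add: bij_betw_def)
  ultimately show ?l
    using bij N by (intro exI[of _ "u \<circ> ?h"]) (simp add: struct_iso_def)
qed

lemma expressible_has_r_type:
  fixes \<tau> :: "(('r, 'a) rel_structure \<times> 'a) set"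
  assumes \<sigma>: "relational_signature \<sigma>" and \<tau>: "\<tau> \<in> r_types \<sigma> r"
  shows "expressible \<sigma> {x} (\<lambda>A v. v x \<in> univ A \<and> has_r_type \<sigma> r A (v x) \<tau>)"
proof -
  obtain C c where C: "(C, c) \<in> balls \<sigma> r" "\<tau> = ball_iso \<sigma> r `` {(C, c)}"
    using \<tau> by (auto simp: r_types_def quotient_def)
  then have C': "C \<in> structures \<sigma>" "c \<in> univ C" "finite (univ C)"
    by (auto simp: mem_balls_iff structures_def)
  \<comment> \<open>One variable for each element of \<open>C\<close>, all above \<open>x\<close>,
    with \<open>y\<close> beyond them, so that none of them clash.\<close>
  define S where "S = {Suc x..<Suc x + card (univ C)}"
  define y where "y = Suc x + card (univ C)"
  have fresh: "finite S" "x \<notin> S" "y \<notin> S" "y \<noteq> x"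
    by (auto simp: S_def y_def)
  obtain h where h: "bij_betw h S (univ C)"
    using finite_same_card_bij[of S "univ C"] C'(3) by (auto simp: S_def)
  obtain i where i: "i \<in> S" "h i = c"
    using C'(2) unfolding bij_betw_imp_surj_on[OF h, symmetric] by blast
  \<comment> \<open>In order: the listed elements are distinct, the centre has index
    \<open>i\<close>, the list is exactly the \<open>r\<close>-neighbourhood, and its atomic diagram
    is that of \<open>C\<close>. Facts about the fixed \<open>C\<close> enter as constants.\<close>
  let ?Q = "\<lambda>A v. (\<forall>i\<in>S. \<forall>j\<in>S. v i = v j \<longleftrightarrow> i = j) \<and> v x = v i
    \<and> (\<forall>z\<in>univ A. ((v(y := z)) x, (v(y := z)) y) \<in> (gaifman \<sigma> A)\<^sup>= ^^ r \<longleftrightarrow> (\<exists>j\<in>S. (v(y := z)) y = (v(y := z)) j))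
    \<and> (\<forall>R\<in>syms \<sigma>. \<forall>s\<in>{s. set s \<subseteq> S \<and> length s = arity \<sigma> R}. map v s \<in> rel A R \<longleftrightarrow> map h s \<in> rel C R)"
  have "expressible \<sigma> {x} (\<lambda>A v. \<exists>f. f ` S \<subseteq> univ A \<and> ?Q A (override_on v f S))"
    using \<sigma> fresh i(1)
    by (intro expressible_Ex_many expressible_conj expressible_finite_Ball expressible_iff expressible_eq
        expressible_const expressible_Ball expressible_finite_Bex expressible_atom
        expressible_mono[OF expressible_reach[OF \<sigma>]] finite_lists_length_eq)
      (auto simp: relational_signature_def)
  then show ?thesis
  proof (rule expressible_cong)
    fix A :: "('r, 'a) rel_structure" and v
    assume A: "A \<in> structures \<sigma>"
    have "?Q A (override_on v f S) \<longleftrightarrow> inj_on f S \<and> v x = f i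
      \<and> (\<forall>z\<in>univ A. (v x, z) \<in> (gaifman \<sigma> A)\<^sup>= ^^ r \<longleftrightarrow> (\<exists>j\<in>S. z = f j))
      \<and> (\<forall>R\<in>syms \<sigma>. \<forall>s\<in>{s. set s \<subseteq> S \<and> length s = arity \<sigma> R}. map f s \<in> rel A R \<longleftrightarrow> map h s \<in> rel C R)" for f
    proof -
      define w where "w = override_on v f S"
      have w: "w x = v x" "\<And>j. j \<in> S \<Longrightarrow> w j = f j"
        using fresh(2) by (simp_all add: w_def)
      have "(\<forall>i\<in>S. \<forall>j\<in>S. w i = w j \<longleftrightarrow> i = j) \<longleftrightarrow> inj_on f S"
        using w(2) by (auto simp: inj_on_def)
      moreover have "w x = w i \<longleftrightarrow> v x = f i"
        using w i(1) by simp
      moreover have "(((w(y := z)) x, (w(y := z)) y) \<in> (gaifman \<sigma> A)\<^sup>= ^^ r \<longleftrightarrow> (\<exists>j\<in>S. (w(y := z)) y = (w(y := z)) j))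
          \<longleftrightarrow> ((v x, z) \<in> (gaifman \<sigma> A)\<^sup>= ^^ r \<longleftrightarrow> (\<exists>j\<in>S. z = f j))" for z
      proof -
        have "(\<exists>j\<in>S. (w(y := z)) y = (w(y := z)) j) \<longleftrightarrow> (\<exists>j\<in>S. z = f j)"
          using fresh(3) w(2) by (intro bex_cong refl) auto
        then show ?thesis
          using fresh(4) w(1) by simp
      qed
      moreover have "map w s = map f s" if "set s \<subseteq> S" for s
        using that w(2) by auto
      ultimately show ?thesis
        unfolding w_def[symmetric] by (simp del: map_eq_conv)
    qed
    then have "(\<exists>f. f ` S \<subseteq> univ A \<and> ?Q A (override_on v f S)) \<longleftrightarrow>
      (\<exists>u. u ` S \<subseteq> univ A \<and> inj_on u S \<and> v x = u i
      \<and> (\<forall>z\<in>univ A. (v x, z) \<in> (gaifman \<sigma> A)\<^sup>= ^^ r \<longleftrightarrow> (\<exists>j\<in>S. z = u j))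
      \<and> (\<forall>R\<in>syms \<sigma>. \<forall>s\<in>{s. set s \<subseteq> S \<and> length s = arity \<sigma> R}. map u s \<in> rel A R \<longleftrightarrow> map h s \<in> rel C R))"
      (is "?e \<longleftrightarrow> ?e'")
      by simp
    \<comment> \<open>The centre is among the witnesses, which forces even an unrestricted valuation
      to place \<open>x\<close> in the universe.\<close>
    moreover have "v x \<in> univ A" if ?e'
      using that i(1) by blast
    moreover have "?e' \<longleftrightarrow> has_r_type \<sigma> r A (v x) \<tau>" if "v x \<in> univ A"
      unfolding struct_iso_induced_iff_enumeration[OF A that C'(1) h i(1), symmetric]
        has_r_type_iff_struct_iso[OF A that C(1)] C(2) i(2)
      by (rule refl)
    ultimately show "?e \<longleftrightarrow> v x \<in> univ A \<and> has_r_type \<sigma> r A (v x) \<tau>"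
      by blast
  qed
qed

text \<open>Counting up to \<open>k\<close> amounts to \<open>k\<close> pairwise distinct witnesses,
  that is, an injection from \<open>{0..<k}\<close>.\<close>

lemma expressible_card_ge:
  fixes \<tau> :: "(('r, 'a) rel_structure \<times> 'a) set"
  assumes \<sigma>: "relational_signature \<sigma>" and \<tau>: "\<tau> \<in> r_types \<sigma> r"
  shows "expressible \<sigma> {} (\<lambda>A v. k \<le> card {a \<in> univ A. has_r_type \<sigma> r A a \<tau>})"
proof -
  let ?S = "{0..<k}"
  have "expressible \<sigma> {} (\<lambda>A v. \<exists>f. f ` ?S \<subseteq> univ A \<and>
      (\<forall>i\<in>?S. \<forall>j\<in>?S. override_on v f ?S i = override_on v f ?S j \<longleftrightarrow> i = j) \<and>
      (\<forall>i\<in>?S. override_on v f ?S i \<in> univ A \<and> has_r_type \<sigma> r A (override_on v f ?S i) \<tau>))"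
    by (intro expressible_Ex_many expressible_conj[of _ _ "\<lambda>A v. \<forall>i\<in>?S. \<forall>j\<in>?S. v i = v j \<longleftrightarrow> i = j"]
        expressible_finite_Ball expressible_iff expressible_eq expressible_const
        expressible_mono[OF expressible_has_r_type[OF \<sigma> \<tau>]]) auto
  then show ?thesis
  proof (rule expressible_cong)
    fix A :: "('r, 'a) rel_structure" and v
    assume A: "A \<in> structures \<sigma>"
    let ?T = "{a \<in> univ A. has_r_type \<sigma> r A a \<tau>}"
    have fin: "finite ?T"
      using A by (simp add: structures_def)
    have "(\<exists>f. f ` ?S \<subseteq> univ A \<and>
      (\<forall>i\<in>?S. \<forall>j\<in>?S. override_on v f ?S i = override_on v f ?S j \<longleftrightarrow> i = j) \<and>
      (\<forall>i\<in>?S. override_on v f ?S i \<in> univ A \<and> has_r_type \<sigma> r A (override_on v f ?S i) \<tau>)) \<longleftrightarrow>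
      (\<exists>f. f ` ?S \<subseteq> ?T \<and> inj_on f ?S)" (is "?l \<longleftrightarrow> _")
      unfolding inj_on_def by (intro arg_cong[where f = Ex] ext) auto
    also have "\<dots> \<longleftrightarrow> k \<le> card ?T"
      using card_le_inj[of ?S ?T] card_inj_on_le[of _ ?S ?T] fin by auto
    finally show "?l \<longleftrightarrow> k \<le> card ?T" .
  qed
qed

lemma expressible_histogram_mem:
  fixes \<sigma> :: "'r signature"
  assumes \<sigma>: "relational_signature \<sigma>" and J: "J \<in> profile_intervals"
    and i: "i \<in> {1..num_r_types TYPE(('r, 'a::infinite) rel_structure) \<sigma> d r}"
  shows "expressible \<sigma> {} (\<lambda>(A :: ('r, 'a) rel_structure) v. histogram \<sigma> d r A i \<in> J)"
proof -
  have ge: "expressible \<sigma> {} (\<lambda>(A :: ('r, 'a) rel_structure) v. k \<le> histogram \<sigma> d r A i)" for k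
    unfolding histogram_def by (rule expressible_card_ge[OF \<sigma> r_type_enum[OF \<sigma> i]])
  from J consider k l where "J = {k..l}" | k where "J = {k..}"
    by (auto simp: profile_intervals_def)
  then show ?thesis
  proof cases
    case 1
    then show ?thesis
      \<comment> \<open>The upper bound \<open>l\<close> is the negation of the lower bound
        \<open>Suc l\<close>.\<close>
      using expressible_conj[OF ge[of k] expressible_not[OF ge[of "Suc l"]]] by (simp add: not_less_eq_eq)
  next
    case 2
    then show ?thesis
      using ge[of k] by simp
  qed
qed

text \<open>The union becomes a finite disjunction and each profile a finite conjunction over its
  own types, so the radii may differ; the empty union becomes the constant false.\<close>

lemma profiles_imp_fo_definable:
  fixes \<sigma> :: "'r signature" and r :: "nat \<Rightarrow> nat"
  assumes \<sigma>: "relational_signature \<sigma>"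
    and \<rho>: "\<forall>i\<in>{1..k}. nbhd_profile TYPE(('r, 'a::infinite) rel_structure) \<sigma> d (r i) (\<rho> i)"
  shows "fo_definable \<sigma> d
    (\<Union>i\<in>{1..k}. profile_property \<sigma> d (r i) (\<rho> i) :: ('r, 'a) rel_structure set)"
proof -
  let ?Q = "\<lambda>A :: ('r, 'a) rel_structure. \<exists>i\<in>{1..k}.
    \<forall>j\<in>{1..num_r_types TYPE(('r, 'a) rel_structure) \<sigma> d (r i)}. histogram \<sigma> d (r i) A j \<in> \<rho> i j"
  have "expressible \<sigma> {} (\<lambda>A v. ?Q A)"
    using \<rho> unfolding nbhd_profile_def
    by (intro expressible_finite_Bex expressible_finite_Ball expressible_histogram_mem[OF \<sigma>])
      (blast intro: Pi_mem finite_atLeastAtMost)+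
  then obtain \<phi> where \<phi>: "fo_over \<sigma> \<phi>" "free_vars \<phi> \<subseteq> {}"
    "\<And>A v. A \<in> structures \<sigma> \<Longrightarrow> sat A v \<phi> \<longleftrightarrow> ?Q A"
    unfolding expressible_def by blast
  then have "(\<Union>i\<in>{1..k}. profile_property \<sigma> d (r i) (\<rho> i) :: ('r, 'a) rel_structure set) = {A \<in> bounded_structures \<sigma> d. A \<Turnstile> \<phi>}"
    by (auto simp: profile_property_def bounded_structures_def models_def)
  then show ?thesis
    using \<phi>(1,2) unfolding fo_definable_def fo_sentence_def by blast
qed

theorem lemma3p2:
  fixes \<sigma> :: "'r signature" and d :: nat and P :: "('r, 'a::infinite) rel_structure set"
  assumes "relational_signature \<sigma>"
    and "is_property \<sigma> d P"
    and "P \<noteq> {}"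
  shows "fo_definable \<sigma> d P \<longleftrightarrow>
    (\<exists>(k::nat) (r :: nat \<Rightarrow> nat) (\<rho> :: nat \<Rightarrow> nat \<Rightarrow> nat set).
       (\<forall>i\<in>{1..k}. nbhd_profile TYPE(('r, 'a) rel_structure) \<sigma> d (r i) (\<rho> i)) \<and>
       P = (\<Union>i\<in>{1..k}. profile_property \<sigma> d (r i) (\<rho> i)))"
proof
  assume "fo_definable \<sigma> d P"
  then show "\<exists>(k::nat) (r :: nat \<Rightarrow> nat) (\<rho> :: nat \<Rightarrow> nat \<Rightarrow> nat set).
       (\<forall>i\<in>{1..k}. nbhd_profile TYPE(('r, 'a) rel_structure) \<sigma> d (r i) (\<rho> i)) \<and>
       P = (\<Union>i\<in>{1..k}. profile_property \<sigma> d (r i) (\<rho> i))"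
    by (rule fo_definable_imp_profiles[OF assms(1)])
next
  assume "\<exists>(k::nat) (r :: nat \<Rightarrow> nat) (\<rho> :: nat \<Rightarrow> nat \<Rightarrow> nat set).
       (\<forall>i\<in>{1..k}. nbhd_profile TYPE(('r, 'a) rel_structure) \<sigma> d (r i) (\<rho> i)) \<and>
       P = (\<Union>i\<in>{1..k}. profile_property \<sigma> d (r i) (\<rho> i))"
  then show "fo_definable \<sigma> d P"
    by (elim exE conjE) (simp only: profiles_imp_fo_definable[OF assms(1)])
qed

end
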